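(* Let $\mu\in(0,\infty)$ be a fixed number and let $T\sim F_T$ be a nonnegative random variable. Then $$0\le \mathsf{E}[T]<1$$ if and only if the functional equation (of compound-Poisson type) $$\hat F(s)=\exp(-\sigma(s)),\quad s\ge 0,$$ has exactly one solution $X\sim F$ (a distribution $F$ of a nonnegative random variable $X$) with mean $\mu$ and finite variance. Moreover, in this case, $$\mathsf{Var}[X]=\frac{\mathsf{E}[T]}{1-\mathsf{E}[T]}\,\mu^2 .$$
   Context: For a nonnegative random variable $Y$, $Y\sim F_Y$ means that $Y$ has distribution function $F_Y$, and $\hat F_Y(s)=\mathsf{E}[e^{-sY}]=\int_0^\infty e^{-sy}\,\mathrm{d}F_Y(y)$, $s\ge0$, is its Laplace–Stieltjes transform. Integrals $\int_0^\infty$ with respect to distributions include a possible atom at $0$. For a distribution $F$ on $[0,\infty)$ with mean $\mu\in(0,\infty)$ (the unknown of the equation), define $$\sigma(s)=\int_0^\infty\frac{1-\hat F(ts)}{t}\,\mathrm{d}F_T(t),\quad s\ge0,$$ where the integrand at $t=0$ is defined by continuity to be $\mu s$. Equivalently, $\sigma(s)=\mu\int_0^s\hat F_{TZ}(x)\,\mathrm{d}x$, where $Z$ is independent of $T$ and has the length-biased distribution $F_Z(z)=\frac1\mu\int_0^z x\,\mathrm{d}F(x)$, $z\ge0$. Note that $\sigma$ depends on the unknown $F$. *)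

theory Defs
  imports "HOL-Probability.Probability"
begin

text \<open>
  A probability distribution on \<open>[0,\<infinity>)\<close> is represented by the Borel measure on the reals that its
  distribution function determines.
\<close>

definition nonneg_distribution :: "real measure \<Rightarrow> bool" where
  "nonneg_distribution F \<longleftrightarrow> real_distribution F \<and> (AE x in F. 0 \<le> x)"

definition laplace_stieltjes :: "real measure \<Rightarrow> real \<Rightarrow> real" where
  "laplace_stieltjes F s = (LINT y:{0..}|F. exp (- (s * y)))"

text \<open>
  The closed half-line includes an atom of \<open>FT\<close> at \<open>0\<close>; there the integrand takes its limit as
  \<open>t\<close> tends to \<open>0\<close> from the right, which is the mean of \<open>F\<close> times \<open>s\<close> (division by zero
  would give \<open>0\<close>).
  When \<open>F\<close> is a distribution on \<open>[0,\<infinity>)\<close> with finite mean, the integrand is bounded on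
  \<open>[0,\<infinity>)\<close>, so the integral exists for every distribution \<open>FT\<close>.
\<close>

definition sigma_transform :: "real measure \<Rightarrow> real measure \<Rightarrow> real \<Rightarrow> real" where
  "sigma_transform FT F s =
     (LINT t:{0..}|FT. if t = 0 then prob_space.expectation F (\<lambda>x. x) * s
                       else (1 - laplace_stieltjes F (t * s)) / t)"

definition solves_compound_poisson_eq :: "real measure \<Rightarrow> real measure \<Rightarrow> bool" where
  "solves_compound_poisson_eq FT F \<longleftrightarrow>
     (\<forall>s\<ge>0. laplace_stieltjes F s = exp (- sigma_transform FT F s))"

text \<open>The integrability conditions are needed because a divergent integral has value \<open>0\<close>.\<close>

definition has_mean_finite_variance :: "real measure \<Rightarrow> real \<Rightarrow> bool" where
  "has_mean_finite_variance F \<mu> \<longleftrightarrow>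
     integrable F (\<lambda>x. x) \<and> prob_space.expectation F (\<lambda>x. x) = \<mu> \<and>
     integrable F (\<lambda>x. (x - \<mu>)\<^sup>2)"

end

theory Submission
  imports Defs "HOL-Real_Asymp.Real_Asymp"
begin

text \<open>
  Write \<open>L F\<close> for the transform of \<open>F\<close>, \<open>m2(F)\<close> for its second moment and \<open>q = E T\<close>.

  Everything turns on one relation between second moments. If \<open>F\<close> and \<open>G\<close> have mean \<open>\<mu>\<close>, finite variance,
  and \<open>L G s = exp (- \<sigma> s)\<close> with \<open>\<sigma>\<close> formed from \<open>F\<close>, then comparing the terms of order \<open>s\<^sup>2\<close> as
  \<open>s\<close> tends to \<open>0\<close> shows that \<open>T\<close> is integrable and \<open>q * m2(F) = Var G\<close> (\<open>second_moment_relation\<close>).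
  For \<open>G = F\<close> this is \<open>(1 - q) * m2(F) = \<mu>\<^sup>2\<close>: any solution forces \<open>q < 1\<close> and has the stated variance
  (\<open>solution_moments\<close>).

  Conversely let \<open>q < 1\<close>. Two solutions with the same mean and finite variance have transforms that
  differ by at most a constant times \<open>s\<^sup>2\<close>, and each application of the equation multiplies this
  constant by \<open>q\<close>; hence the transforms agree and so do the laws (\<open>solution_unique\<close>, \<open>laplace_unique\<close>).

  For existence, \<open>exp (- \<sigma>)\<close> is the transform of a law as soon as \<open>q\<close> is finite: it is the limit of
  \<open>(1 - \<sigma>\<^sub>n / n) ^ n\<close>, where \<open>1 - \<sigma>\<^sub>n / n\<close> is the transform of a randomly thinned copy of \<open>max T (1 / n) * X\<close>
  (\<open>exp_sigma_is_laplace\<close>). Iterating from the point mass at \<open>\<mu>\<close> gives an increasing sequence of transforms,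
  while the second-moment relation keeps the second moments below \<open>\<mu>\<^sup>2 / (1 - q)\<close>. Both limits are
  transforms of laws with mean \<open>\<mu>\<close> by a continuity theorem for laws with bounded second moments
  (\<open>laplace_limit_is_law\<close>), and the second limit solves the equation
  (\<open>compound_poisson_solution_exists\<close>).
\<close>

section \<open>Laplace transforms of nonnegative laws\<close>

locale nonneg_law = real_distribution F for F +
  assumes nonneg: "AE x in F. 0 \<le> x"

lemma nonneg_distribution_iff_law: "nonneg_distribution F \<longleftrightarrow> nonneg_law F"
  by (simp add: nonneg_distribution_def nonneg_law_def nonneg_law_axioms_def)

context nonneg_law
begin

lemma integrable_exp_minus:
  assumes "0 \<le> s"
  shows "integrable F (\<lambda>y. exp (- (s * y)))"
proof (rule integrable_const_bound[where B = 1])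
  show "AE y in F. norm (exp (- (s * y))) \<le> 1"
    using nonneg by eventually_elim (use assms in auto)
qed auto

lemma laplace_eq: "laplace_stieltjes F s = expectation (\<lambda>y. exp (- (s * y)))"
  unfolding laplace_stieltjes_def set_lebesgue_integral_def
proof (rule integral_cong_AE)
  show "AE y in F. indicator {0..} y *\<^sub>R exp (- (s * y)) = exp (- (s * y))"
    using nonneg by eventually_elim auto
qed auto

lemma laplace_nonneg: "0 \<le> laplace_stieltjes F s"
  unfolding laplace_eq by simp

lemma laplace_le_1:
  assumes "0 \<le> s"
  shows "laplace_stieltjes F s \<le> 1"
  unfolding laplace_eq
proof (rule integral_le_const)
  show "AE y in F. exp (- (s * y)) \<le> 1"
    using nonneg by eventually_elim (use assms in auto)
qed (rule integrable_exp_minus[OF assms])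

lemma measurable_laplace [measurable]: "laplace_stieltjes F \<in> borel_measurable borel"
proof -
  have "(\<lambda>s. expectation (\<lambda>y. exp (- (s * y)))) \<in> borel_measurable borel"
    by measurable
  then show ?thesis
    by (simp add: laplace_eq[abs_def])
qed

end

lemma exp_minus_taylor_bounds:
  fixes y :: real
  assumes "0 \<le> y"
  shows "0 \<le> exp (- y) - 1 + y" and "exp (- y) - 1 + y \<le> y\<^sup>2 / 2"
proof -
  show "0 \<le> exp (- y) - 1 + y"
    using exp_ge_add_one_self[of "-y"] by simp
  have "(\<lambda>x. x\<^sup>2 / 2 - (exp (- x) - 1 + x)) 0 \<le> (\<lambda>x. x\<^sup>2 / 2 - (exp (- x) - 1 + x)) y"
  proof (rule DERIV_nonneg_imp_nondecreasing[OF assms])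
    fix x :: real assume "0 \<le> x"
    have "((\<lambda>x. x\<^sup>2 / 2 - (exp (- x) - 1 + x)) has_real_derivative (exp (- x) - 1 + x)) (at x)"
      by (auto intro!: derivative_eq_intros)
    then show "\<exists>d. ((\<lambda>x. x\<^sup>2 / 2 - (exp (- x) - 1 + x)) has_real_derivative d) (at x) \<and> 0 \<le> d"
      using exp_ge_add_one_self[of "-x"] by (intro exI[of _ "exp (- x) - 1 + x"]) auto
  qed
  then show "exp (- y) - 1 + y \<le> y\<^sup>2 / 2" by simp
qed

text \<open>
  All second-order information is read off the remainder \<open>exp (- y) - 1 + y\<close>, which lies between
  \<open>0\<close> and \<open>y\<^sup>2 / 2\<close> on the half-line. Its expectation has the leading coefficient \<open>m2 / 2\<close>, and
  the equation acts on \<open>m2\<close> by an affine map; the variance is recovered from \<open>m2\<close> at the end.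
\<close>
locale second_order_law = nonneg_law F for F and \<mu> :: real +
  assumes integrable_id: "integrable F (\<lambda>x. x)"
    and mean: "expectation (\<lambda>x. x) = \<mu>"
    and integrable_square: "integrable F (\<lambda>x. x\<^sup>2)"
begin

abbreviation "m2 \<equiv> expectation (\<lambda>x. x\<^sup>2)"

lemma variance_eq_m2: "variance (\<lambda>x. x) = m2 - \<mu>\<^sup>2"
  using variance_eq[OF integrable_id integrable_square] by (simp add: mean)

lemma mean_square_le_m2: "\<mu>\<^sup>2 \<le> m2"
  using variance_positive[of "\<lambda>x. x"] variance_eq_m2 by simp

lemma mean_nonneg: "0 \<le> \<mu>"
  using integral_nonneg_AE[OF nonneg] mean by simp

lemma laplace_remainder_eq:
  assumes "0 \<le> s"
  shows "laplace_stieltjes F s - 1 + \<mu> * s = expectation (\<lambda>y. exp (- (s * y)) - 1 + s * y)"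
  using integrable_exp_minus[OF assms] integrable_id prob_space
  by (simp add: laplace_eq mean)

lemma laplace_remainder_nonneg:
  assumes "0 \<le> s"
  shows "0 \<le> laplace_stieltjes F s - 1 + \<mu> * s"
  unfolding laplace_remainder_eq[OF assms]
  using nonneg
  by (intro integral_nonneg_AE, eventually_elim)
     (use assms exp_minus_taylor_bounds(1) in auto)

lemma laplace_remainder_le:
  assumes "0 \<le> s"
  shows "laplace_stieltjes F s - 1 + \<mu> * s \<le> m2 / 2 * s\<^sup>2"
proof -
  have "expectation (\<lambda>y. exp (- (s * y)) - 1 + s * y) \<le> expectation (\<lambda>y. s\<^sup>2 / 2 * y\<^sup>2)"
  proof (rule integral_mono_AE)
    show "AE y in F. exp (- (s * y)) - 1 + s * y \<le> s\<^sup>2 / 2 * y\<^sup>2"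
      using nonneg
    proof eventually_elim
      case (elim y)
      then show ?case
        using exp_minus_taylor_bounds(2)[of "s * y"] assms by (simp add: power_mult_distrib)
    qed
  qed (use assms integrable_exp_minus integrable_id integrable_square in auto)
  also have "\<dots> = m2 / 2 * s\<^sup>2" by simp
  finally show ?thesis
    by (simp add: laplace_remainder_eq[OF assms])
qed

lemma one_minus_laplace_le:
  assumes "0 \<le> s"
  shows "1 - laplace_stieltjes F s \<le> \<mu> * s"
  using laplace_remainder_nonneg[OF assms] by simp

text \<open>
  After division by \<open>(u n)\<^sup>2\<close> the pointwise remainder is dominated by \<open>y\<^sup>2 / 2\<close> and tends to it, so
  the limit passes through the expectation.
\<close>
lemma laplace_second_order:
  assumes pos: "\<And>n. 0 < u n" and lim: "u \<longlonglongrightarrow> 0"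
  shows "(\<lambda>n. (laplace_stieltjes F (u n) - 1 + \<mu> * u n) / (u n)\<^sup>2) \<longlonglongrightarrow> m2 / 2"
proof -
  define k where "k n y = (exp (- (u n * y)) - 1 + u n * y) / (u n)\<^sup>2" for n y
  have "(\<lambda>n. expectation (k n)) \<longlonglongrightarrow> expectation (\<lambda>y. y\<^sup>2 / 2)"
  proof (rule integral_dominated_convergence)
    show "integrable F (\<lambda>y. y\<^sup>2 / 2)" using integrable_square by simp
    show "k n \<in> borel_measurable F" for n unfolding k_def by measurable
    show "AE y in F. norm (k n y) \<le> y\<^sup>2 / 2" for n
      using nonneg
    proof eventually_elim
      case (elim y)
      have "0 \<le> u n * y" using pos[of n] elim by simp
      from exp_minus_taylor_bounds[OF this] show ?case
        using pos[of n] by (simp add: k_def divide_simps power_mult_distrib mult_ac)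
    qed
    show "AE y in F. (\<lambda>n. k n y) \<longlonglongrightarrow> y\<^sup>2 / 2"
      using nonneg
    proof eventually_elim
      case (elim y)
      show ?case
      proof (cases "y = 0")
        case False
        with elim have y: "0 < y" by simp
        have at: "filterlim u (at_right 0) sequentially"
          using lim by (simp add: filterlim_at pos less_imp_neq[OF pos, symmetric])
        have "((\<lambda>v. (exp (- (v * y)) - 1 + v * y) / v\<^sup>2) \<longlongrightarrow> y * y / 2) (at_right 0)"
          using y by real_asymp
        from filterlim_compose[OF this at] show ?thesis by (simp add: k_def power2_eq_square)
      qed (simp add: k_def)
    qed
  qed simp
  moreover have "expectation (k n) = (laplace_stieltjes F (u n) - 1 + \<mu> * u n) / (u n)\<^sup>2" for n
    using pos[of n] by (simp add: k_def[abs_def] laplace_remainder_eq)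
  ultimately show ?thesis by simp
qed

end

lemma second_order_law_iff:
  "nonneg_distribution F \<and> has_mean_finite_variance F \<mu> \<longleftrightarrow> second_order_law F \<mu>"
proof
  assume asm: "nonneg_distribution F \<and> has_mean_finite_variance F \<mu>"
  then interpret nonneg_law F by (simp add: nonneg_distribution_iff_law)
  have i: "integrable F (\<lambda>x. x)" "integrable F (\<lambda>x. (x - \<mu>)\<^sup>2)" "expectation (\<lambda>x. x) = \<mu>"
    using asm by (auto simp: has_mean_finite_variance_def)
  have "integrable F (\<lambda>x. (x - \<mu>)\<^sup>2 + 2 * \<mu> * x - \<mu>\<^sup>2)"
    using i by auto
  also have "(\<lambda>x. (x - \<mu>)\<^sup>2 + 2 * \<mu> * x - \<mu>\<^sup>2) = (\<lambda>x. x\<^sup>2)"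
    by (auto simp: power2_eq_square algebra_simps)
  finally show "second_order_law F \<mu>"
    using i by unfold_locales auto
next
  assume "second_order_law F \<mu>"
  then interpret second_order_law F \<mu> .
  have "integrable F (\<lambda>x. x\<^sup>2 - 2 * \<mu> * x + \<mu>\<^sup>2)"
    using integrable_id integrable_square by auto
  also have "(\<lambda>x. x\<^sup>2 - 2 * \<mu> * x + \<mu>\<^sup>2) = (\<lambda>x. (x - \<mu>)\<^sup>2)"
    by (auto simp: power2_eq_square algebra_simps)
  finally show "nonneg_distribution F \<and> has_mean_finite_variance F \<mu>"
    using integrable_id mean nonneg_law_axioms
    by (simp add: has_mean_finite_variance_def nonneg_distribution_iff_law)
qed

section \<open>Uniqueness and continuity of the Laplace transform\<close>

text \<open>
  With \<open>y = exp (- x)\<close>, the half-line becomes \<open>(0,1]\<close> and the values of the transform at the natural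
  numbers become the moments of \<open>y\<close>, hence determine the integral of every polynomial in \<open>y\<close>.
  By Weierstrass they determine the integral of every continuous function on \<open>[0,1]\<close>.
\<close>
lemma laplace_eq_imp_integral_cts_step_eq:
  assumes "nonneg_law F" "nonneg_law G" "a < b"
    and eq: "\<And>n::nat. laplace_stieltjes F (real n) = laplace_stieltjes G (real n)"
  shows "integral\<^sup>L F (cts_step a b) = integral\<^sup>L G (cts_step a b)"
proof -
  interpret F: nonneg_law F by fact
  interpret G: nonneg_law G by fact
  \<comment> \<open>The step is \<open>0\<close> to the right of \<open>b\<close>, so cutting \<open>y\<close> off at \<open>exp (- b)\<close> changes nothing and
    removes the singularity of \<open>ln\<close> at \<open>0\<close>.\<close>
  define g where "g y = cts_step a b (- ln (max y (exp (- b))))" for y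
  have g: "g (exp (- x)) = cts_step a b x" for x
    using \<open>a < b\<close> by (cases "x \<le> b") (auto simp: g_def cts_step_def max_def)
  have max_pos: "max y (exp (- b)) \<noteq> 0" for y :: real
    using exp_gt_zero[of "- b"] less_max_iff_disj[of 0 y "exp (- b)"] by linarith
  have contg: "continuous_on {0..1} g"
    unfolding g_def
    by (rule continuous_on_compose2[OF uniformly_continuous_imp_continuous[OF cts_step_uniformly_continuous[OF \<open>a < b\<close>]]])
       (auto intro!: continuous_on_minus continuous_on_ln continuous_on_max
          continuous_on_id continuous_on_const simp: max_pos)
  have "\<bar>integral\<^sup>L F (cts_step a b) - integral\<^sup>L G (cts_step a b)\<bar> < 2 * e" if "0 < e" for e
  proof -
    obtain q where q: "real_polynomial_function q" "\<And>y. y \<in> {0..1} \<Longrightarrow> \<bar>g y - q y\<bar> < e"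
      using Stone_Weierstrass_real_polynomial_function[OF _ contg \<open>0 < e\<close>] by auto
    then obtain c n where c: "q = (\<lambda>y. \<Sum>i\<le>n. c i * y ^ i)"
      by (auto simp: real_polynomial_function_iff_sum)
    have approx: "integrable H (\<lambda>x. q (exp (- x)))
        \<and> integral\<^sup>L H (\<lambda>x. q (exp (- x))) = (\<Sum>i\<le>n. c i * laplace_stieltjes H (real i))
        \<and> \<bar>integral\<^sup>L H (cts_step a b) - integral\<^sup>L H (\<lambda>x. q (exp (- x)))\<bar> < e"
      if "nonneg_law H" for H
    proof -
      interpret nonneg_law H by fact
      have pow: "exp (- x) ^ i = exp (- (real i * x))" for x :: real and i :: nat
        by (simp add: exp_of_nat_mult[symmetric])
      have int: "integrable H (\<lambda>x. q (exp (- x)))"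
        unfolding c pow by (intro Bochner_Integration.integrable_sum integrable_mult_right integrable_exp_minus) auto
      have ints: "integrable H (cts_step a b)"
        by (rule integrable_cts_step[OF \<open>a < b\<close>])
      have "integral\<^sup>L H (\<lambda>x. q (exp (- x))) = (\<Sum>i\<le>n. c i * laplace_stieltjes H (real i))"
        unfolding c pow laplace_eq
        by (subst Bochner_Integration.integral_sum)
           (auto intro!: integrable_mult_right integrable_exp_minus)
      moreover have "\<bar>integral\<^sup>L H (\<lambda>x. cts_step a b x - q (exp (- x)))\<bar> < e"
      proof -
        have ae: "AE x in H. \<bar>cts_step a b x - q (exp (- x))\<bar> < e"
          using nonneg
          by eventually_elim (use q(2) g in \<open>metis atLeastAtMost_iff exp_ge_zero exp_le_one_iff neg_le_0_iff_le\<close>)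
        have "\<bar>integral\<^sup>L H (\<lambda>x. cts_step a b x - q (exp (- x)))\<bar>
            \<le> integral\<^sup>L H (\<lambda>x. \<bar>cts_step a b x - q (exp (- x))\<bar>)"
          by (rule integral_abs_bound)
        also have "\<dots> < integral\<^sup>L H (\<lambda>x. e)"
          by (rule integral_less_AE_space) (use ae int ints emeasure_space_1 in auto)
        finally show ?thesis using prob_space by simp
      qed
      ultimately show ?thesis using int ints by simp
    qed
    show ?thesis
    proof -
      have "integral\<^sup>L F (\<lambda>x. q (exp (- x))) = integral\<^sup>L G (\<lambda>x. q (exp (- x)))"
        using approx[OF assms(1)] approx[OF assms(2)] by (simp only: eq)
      then show ?thesis
        using approx[OF assms(1)] approx[OF assms(2)] by linarith
    qed
  qed
  from this[of "\<bar>integral\<^sup>L F (cts_step a b) - integral\<^sup>L G (cts_step a b)\<bar> / 2"]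
  show ?thesis by fastforce
qed

text \<open>
  Equality of the integrals of all \<open>cts_step\<close> functions says that the constant sequence \<open>F\<close> converges
  weakly to \<open>G\<close>, so the two characteristic functions agree.
\<close>
lemma laplace_unique:
  assumes "nonneg_law F" "nonneg_law G"
    and eq: "\<And>n::nat. laplace_stieltjes F (real n) = laplace_stieltjes G (real n)"
  shows "F = G"
proof -
  interpret F: nonneg_law F by fact
  interpret G: nonneg_law G by fact
  have "weak_conv_m (\<lambda>_. F) G"
    by (rule integral_cts_step_conv_imp_weak_conv)
       (simp_all add: laplace_eq_imp_integral_cts_step_eq[OF assms(1,2) _ eq]
          F.real_distribution_axioms G.real_distribution_axioms)
  from levy_continuity1[OF _ _ this] have "(\<lambda>_::nat. char F t) \<longlonglongrightarrow> char G t" for t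
    by (simp add: F.real_distribution_axioms G.real_distribution_axioms)
  then have "char F = char G"
    by (auto intro!: ext LIMSEQ_unique[OF tendsto_const])
  then show ?thesis
    by (rule Levy_uniqueness[OF F.real_distribution_axioms G.real_distribution_axioms])
qed

text \<open>
  Fatou's lemma in the form used twice below: integrability of the limit comes out as a conclusion.
  This is what makes the existence of a solution force \<open>T\<close> to be integrable.
\<close>
lemma integral_le_of_tendsto:
  fixes f :: "nat \<Rightarrow> 'a \<Rightarrow> real"
  assumes int: "\<And>n. integrable M (f n)" and [measurable]: "g \<in> borel_measurable M"
    and nonneg: "\<And>n. AE x in M. 0 \<le> f n x"
    and conv: "AE x in M. (\<lambda>n. f n x) \<longlonglongrightarrow> g x"
    and bound: "\<And>n. integral\<^sup>L M (f n) \<le> c n" and c: "c \<longlonglongrightarrow> C"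
  shows "integrable M g \<and> integral\<^sup>L M g \<le> C"
proof -
  have [measurable]: "f n \<in> borel_measurable M" for n
    using int by blast
  have nonneg_all: "AE x in M. \<forall>n. 0 \<le> f n x"
    using nonneg by (simp add: AE_all_countable)
  have g_nonneg: "AE x in M. 0 \<le> g x"
    using nonneg_all conv by eventually_elim (auto intro: LIMSEQ_le_const)
  have int_nonneg: "0 \<le> integral\<^sup>L M (f n)" for n
    by (rule integral_nonneg_AE[OF nonneg])
  have C: "0 \<le> C"
    by (rule LIMSEQ_le_const[OF c]) (use int_nonneg bound order_trans in blast)
  have "(\<integral>\<^sup>+x. ennreal (g x) \<partial>M) = (\<integral>\<^sup>+x. liminf (\<lambda>n. ennreal (f n x)) \<partial>M)"
  proof (rule nn_integral_cong_AE)
    show "AE x in M. ennreal (g x) = liminf (\<lambda>n. ennreal (f n x))"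
      using conv by eventually_elim (auto intro!: lim_imp_Liminf[symmetric] tendsto_ennrealI)
  qed
  also have "\<dots> \<le> liminf (\<lambda>n. \<integral>\<^sup>+x. ennreal (f n x) \<partial>M)"
    by (rule nn_integral_liminf) measurable
  also have "\<dots> = liminf (\<lambda>n. ennreal (integral\<^sup>L M (f n)))"
    using nn_integral_eq_integral[OF int nonneg] by simp
  also have "\<dots> \<le> liminf (\<lambda>n. ennreal (c n))"
    by (intro Liminf_mono always_eventually allI ennreal_leI bound)
  also have "\<dots> = ennreal C"
    using c by (intro lim_imp_Liminf tendsto_ennrealI) auto
  finally have le: "(\<integral>\<^sup>+x. ennreal (g x) \<partial>M) \<le> ennreal C" .
  have "integrable M g"
    using le g_nonneg by (intro integrableI_nonneg) (auto simp: top_unique less_top[symmetric])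
  moreover have "integral\<^sup>L M g \<le> C"
    using le nn_integral_eq_integral[OF \<open>integrable M g\<close> g_nonneg] C by simp
  ultimately show ?thesis ..
qed

lemma tight_of_bounded_second_moments:
  assumes law: "\<And>n. second_order_law (G n) \<mu>"
    and bound: "\<And>n. (LINT x|G n. x\<^sup>2) \<le> C"
  shows "tight G"
  unfolding tight_def
proof (intro conjI allI impI)
  show "real_distribution (G n)" for n
    using law[of n] by (simp add: second_order_law_def nonneg_law_def)
  fix \<epsilon> :: real assume "0 < \<epsilon>"
  have "0 \<le> (LINT x|G 0. x\<^sup>2)" by simp
  also note bound[of 0]
  finally have "0 \<le> C" .
  \<comment> \<open>The level at which Markov's inequality for \<open>x\<^sup>2\<close> gives mass less than \<open>\<epsilon>\<close>; the \<open>+ 1\<close> makes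
    it strict and keeps \<open>c\<close> positive when \<open>C = 0\<close>.\<close>
  define c where "c = (C + 1) / \<epsilon>"
  have "0 < c" using \<open>0 \<le> C\<close> \<open>0 < \<epsilon>\<close> by (simp add: c_def)
  have small: "C / c < \<epsilon>" using \<open>0 \<le> C\<close> \<open>0 < \<epsilon>\<close> by (simp add: c_def divide_simps)
  have "1 - \<epsilon> < measure (G n) {- sqrt c<..sqrt c}" for n
  proof -
    interpret second_order_law "G n" \<mu> by (rule law)
    have "prob {x \<in> space (G n). c \<le> x\<^sup>2} \<le> m2 / c"
      by (rule integral_Markov_inequality_measure[where A = "{}"])
         (use \<open>0 < c\<close> integrable_square in auto)
    also have "\<dots> \<le> C / c"
      using bound[of n] \<open>0 < c\<close> by (simp add: divide_right_mono)
    finally have far: "prob {x \<in> space (G n). c \<le> x\<^sup>2} < \<epsilon>" using small by simp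
    have "1 - prob {- sqrt c<..sqrt c} = prob (space (G n) - {- sqrt c<..sqrt c})"
      by (subst prob_compl) auto
    also have "\<dots> \<le> prob {x \<in> space (G n). c \<le> x\<^sup>2}"
    proof (rule finite_measure_mono)
      show "space (G n) - {- sqrt c<..sqrt c} \<subseteq> {x \<in> space (G n). c \<le> x\<^sup>2}"
      proof clarsimp
        fix x assume "- sqrt c < x \<longrightarrow> \<not> x \<le> sqrt c"
        then have "sqrt c \<le> \<bar>x\<bar>" by linarith
        then show "c \<le> x\<^sup>2" using real_le_rsqrt sqrt_le_D by (metis real_sqrt_abs real_sqrt_le_iff)
      qed
    qed auto
    finally show ?thesis using far by simp
  qed
  moreover have "- sqrt c < sqrt c" using \<open>0 < c\<close> by (meson neg_less_pos real_sqrt_gt_zero)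
  ultimately show "\<exists>a b. a < b \<and> (\<forall>n. 1 - \<epsilon> < measure (G n) {a<..b})" by blast
qed

text \<open>
  A continuity theorem: bounded second moments give tightness, so Helly's theorem provides a weak
  limit along a subsequence, and its transform is the given limit. No mass and no mean is lost: the
  mean of the weak limit is \<open>\<mu>\<close> because both \<open>\<mu> * s\<close> and (mean of \<open>F\<close>) \<open>* s\<close> equal \<open>1 - \<phi> s\<close> up to an error of
  order \<open>s\<^sup>2\<close>, which is uniform along the sequence.
\<close>
lemma laplace_limit_is_law:
  assumes law: "\<And>n. second_order_law (G n) \<mu>"
    and bound: "\<And>n. (LINT x|G n. x\<^sup>2) \<le> C"
    and lim: "\<And>s. 0 \<le> s \<Longrightarrow> (\<lambda>n. laplace_stieltjes (G n) s) \<longlonglongrightarrow> \<phi> s"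
  shows "\<exists>F. second_order_law F \<mu> \<and> (LINT x|F. x\<^sup>2) \<le> C \<and> (\<forall>s\<ge>0. laplace_stieltjes F s = \<phi> s)"
proof -
  have "tight G" by (rule tight_of_bounded_second_moments[OF law bound])
  from tight_imp_convergent_subsubsequence[OF this strict_mono_id]
  obtain r F where r: "strict_mono r" and F: "real_distribution F" and "weak_conv_m (G \<circ> id \<circ> r) F"
    by auto
  then have weak: "weak_conv_m (\<lambda>n. G (r n)) F" by (simp add: comp_def)
  interpret F: real_distribution F by fact
  interpret G: second_order_law "G n" \<mu> for n by (rule law)
  have conv: "(\<lambda>n. LINT x|G (r n). f x) \<longlonglongrightarrow> (LINT x|F. f x)"
    if "\<And>x. isCont f x" "\<And>x. norm (f x) \<le> B" for f :: "real \<Rightarrow> real" and B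
    by (rule weak_conv_imp_integral_bdd_continuous_conv[OF _ F weak that])
       (rule G.real_distribution_axioms)

  have "nonneg_law F"
  proof
    \<comment> \<open>A bounded continuous function whose integral vanishes exactly for laws on the half-line.\<close>
    define f :: "real \<Rightarrow> real" where "f x = min 1 (max 0 (- x))" for x
    have "(\<lambda>n. LINT x|G (r n). f x) \<longlonglongrightarrow> (LINT x|F. f x)"
      by (rule conv[of _ 1]) (auto simp: f_def intro!: continuous_intros)
    moreover have "(LINT x|G (r n). f x) = 0" for n
    proof -
      have "(LINT x|G (r n). f x) = (LINT x|G (r n). 0)"
        by (rule integral_cong_AE)
           (use G.nonneg[of "r n"] in \<open>auto simp: f_def elim: eventually_mono\<close>)
      then show ?thesis by simp
    qed
    ultimately have "(LINT x|F. f x) = 0" by (simp add: LIMSEQ_const_iff)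
    moreover have "integrable F f"
      unfolding f_def by (rule F.integrable_const_bound[where B = 1]) auto
    ultimately have "AE x in F. f x = 0"
      by (subst integral_nonneg_eq_0_iff_AE[symmetric]) (simp_all, simp add: f_def)
    then show "AE x in F. 0 \<le> x"
      by eventually_elim (auto simp: f_def min_def max_def split: if_splits)
  qed
  then interpret F: nonneg_law F .

  have "integrable F (\<lambda>x. x\<^sup>2) \<and> (LINT x|F. x\<^sup>2) \<le> C"
  proof (rule integral_le_of_tendsto[where f = "\<lambda>k x. min (x\<^sup>2) (real k)" and c = "\<lambda>_. C"])
    show "integrable F (\<lambda>x. min (x\<^sup>2) (real k))" for k
      by (rule F.integrable_const_bound[where B = "real k"]) auto
    show "AE x in F. (\<lambda>k. min (x\<^sup>2) (real k)) \<longlonglongrightarrow> x\<^sup>2"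
    proof (intro AE_I2 tendsto_eventually)
      fix x :: real
      obtain N where "x\<^sup>2 \<le> real N" using real_arch_simple by blast
      then show "\<forall>\<^sub>F k in sequentially. min (x\<^sup>2) (real k) = x\<^sup>2"
        by (intro eventually_sequentiallyI[of N]) (simp add: min_absorb1)
    qed
    show "(LINT x|F. min (x\<^sup>2) (real k)) \<le> C" for k
    proof (rule LIMSEQ_le_const2)
      show "(\<lambda>n. LINT x|G (r n). min (x\<^sup>2) (real k)) \<longlonglongrightarrow> (LINT x|F. min (x\<^sup>2) (real k))"
        by (rule conv[of _ "real k"]) (auto intro!: continuous_intros)
      have "(LINT x|G n. min (x\<^sup>2) (real k)) \<le> C" for n
      proof -
        have "integrable (G n) (\<lambda>x. min (x\<^sup>2) (real k))"
          by (rule G.integrable_const_bound[where B = "real k"]) auto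
        then have "(LINT x|G n. min (x\<^sup>2) (real k)) \<le> (LINT x|G n. x\<^sup>2)"
          using G.integrable_square by (intro integral_mono) auto
        then show ?thesis using bound[of n] by simp
      qed
      then show "\<exists>N. \<forall>n\<ge>N. (LINT x|G (r n). min (x\<^sup>2) (real k)) \<le> C" by blast
    qed
  qed auto
  then have sq: "integrable F (\<lambda>x. x\<^sup>2)" and sq_le: "(LINT x|F. x\<^sup>2) \<le> C" by auto

  have laplace: "laplace_stieltjes F s = \<phi> s" if s: "0 \<le> s" for s
  proof -
    have trunc: "laplace_stieltjes H s = (LINT x|H. exp (- (s * max 0 x)))" if "nonneg_law H" for H
    proof -
      interpret nonneg_law H by fact
      show ?thesis
        unfolding laplace_eq
        by (rule integral_cong_AE) (auto intro!: eventually_mono[OF nonneg])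
    qed
    have "(\<lambda>n. LINT x|G (r n). exp (- (s * max 0 x))) \<longlonglongrightarrow> (LINT x|F. exp (- (s * max 0 x)))"
      by (rule conv[of _ 1]) (use s in \<open>auto intro!: continuous_intros\<close>)
    then have "(\<lambda>n. laplace_stieltjes (G (r n)) s) \<longlonglongrightarrow> laplace_stieltjes F s"
      using trunc G.nonneg_law_axioms F.nonneg_law_axioms by simp
    moreover have "(\<lambda>n. laplace_stieltjes (G (r n)) s) \<longlonglongrightarrow> \<phi> s"
      using LIMSEQ_subseq_LIMSEQ[OF lim[OF s] r] by (simp add: comp_def)
    ultimately show ?thesis by (rule LIMSEQ_unique)
  qed

  have id: "integrable F (\<lambda>x. x)"
    using F.square_integrable_imp_integrable[OF _ sq] by simp
  have m: "F.expectation (\<lambda>x. x) = \<mu>"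
  proof -
    interpret F': second_order_law F "F.expectation (\<lambda>x. x)"
      using id sq by unfold_locales auto
    let ?m = "F.expectation (\<lambda>x. x)"
    have close: "\<bar>\<mu> - ?m\<bar> \<le> C / 2 * s" if s: "0 < s" for s
    proof -
      have "(\<lambda>n. laplace_stieltjes (G n) s - 1 + \<mu> * s) \<longlonglongrightarrow> \<phi> s - 1 + \<mu> * s"
        using s by (intro tendsto_intros lim) simp
      moreover have "0 \<le> laplace_stieltjes (G n) s - 1 + \<mu> * s" for n
        using G.laplace_remainder_nonneg[of s n] s by simp
      moreover have "laplace_stieltjes (G n) s - 1 + \<mu> * s \<le> C / 2 * s\<^sup>2" for n
        using s bound[of n] by (intro order_trans[OF G.laplace_remainder_le] mult_right_mono) auto
      ultimately have "0 \<le> \<phi> s - 1 + \<mu> * s" "\<phi> s - 1 + \<mu> * s \<le> C / 2 * s\<^sup>2"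
        by (blast intro: LIMSEQ_le_const, blast intro: LIMSEQ_le_const2)
      moreover have "0 \<le> \<phi> s - 1 + ?m * s"
        using F'.laplace_remainder_nonneg[of s] s laplace[of s] by simp
      moreover have "laplace_stieltjes F s - 1 + ?m * s \<le> C / 2 * s\<^sup>2"
        using s sq_le by (intro order_trans[OF F'.laplace_remainder_le] mult_right_mono) auto
      then have "\<phi> s - 1 + ?m * s \<le> C / 2 * s\<^sup>2"
        using s laplace[of s] by simp
      ultimately have "\<bar>\<mu> * s - ?m * s\<bar> \<le> C / 2 * s\<^sup>2" by linarith
      then have "\<bar>\<mu> - ?m\<bar> * s \<le> (C / 2 * s) * s"
        using s by (simp add: left_diff_distrib[symmetric] abs_mult power2_eq_square)
      then show ?thesis using s by simp
    qed
    have "(\<lambda>n. C / 2 * (1 / real (Suc n))) \<longlonglongrightarrow> C / 2 * 0"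
      using LIMSEQ_inverse_real_of_nat by (intro tendsto_mult tendsto_const) (simp add: inverse_eq_divide)
    then have "\<bar>\<mu> - ?m\<bar> \<le> C / 2 * 0"
      by (rule LIMSEQ_le_const) (intro exI allI impI close, simp)
    then show ?thesis by simp
  qed
  have "second_order_law F \<mu>"
    using id sq m by unfold_locales auto
  then show ?thesis using sq_le laplace by blast
qed

section \<open>The exponent of the equation\<close>

text \<open>
  The mean is a separate argument so that the value at \<open>t = 0\<close> is visibly the limit of the other branch,
  and so that two laws with a common mean have kernels that agree there.
\<close>
definition sigma_kernel :: "real measure \<Rightarrow> real \<Rightarrow> real \<Rightarrow> real \<Rightarrow> real" where
  "sigma_kernel F \<mu> s t = (if t = 0 then \<mu> * s else (1 - laplace_stieltjes F (t * s)) / t)"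

locale transform_setting = T: nonneg_law FT + X: second_order_law F \<mu> for FT F and \<mu> :: real
begin

lemma measurable_sigma_kernel [measurable]: "sigma_kernel F \<mu> s \<in> borel_measurable borel"
  unfolding sigma_kernel_def[abs_def] by measurable

lemma sigma_kernel_bounds:
  assumes "0 \<le> s" "0 \<le> t"
  shows "0 \<le> sigma_kernel F \<mu> s t" "sigma_kernel F \<mu> s t \<le> \<mu> * s"
  using assms X.laplace_le_1[of "t * s"] X.one_minus_laplace_le[of "t * s"] X.mean_nonneg
  by (auto simp: sigma_kernel_def divide_simps mult_ac)

lemma integrable_sigma_kernel:
  assumes "0 \<le> s"
  shows "integrable FT (sigma_kernel F \<mu> s)"
proof (rule T.integrable_const_bound[where B = "\<mu> * s"])
  show "AE t in FT. norm (sigma_kernel F \<mu> s t) \<le> \<mu> * s"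
    using T.nonneg by eventually_elim (use sigma_kernel_bounds[OF assms] in auto)
qed measurable

lemma sigma_transform_eq: "sigma_transform FT F s = T.expectation (sigma_kernel F \<mu> s)"
  unfolding sigma_transform_def set_lebesgue_integral_def
proof (rule integral_cong_AE)
  show "AE t in FT. indicator {0..} t *\<^sub>R (if t = 0 then X.expectation (\<lambda>x. x) * s
      else (1 - laplace_stieltjes F (t * s)) / t) = sigma_kernel F \<mu> s t"
    using T.nonneg by eventually_elim (auto simp: sigma_kernel_def X.mean)
qed measurable

lemma sigma_transform_nonneg:
  assumes "0 \<le> s"
  shows "0 \<le> sigma_transform FT F s"
  unfolding sigma_transform_eq
  by (rule integral_nonneg_AE, rule eventually_mono[OF T.nonneg])
     (rule sigma_kernel_bounds(1)[OF assms])

lemma sigma_transform_le: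
  assumes "0 \<le> s"
  shows "sigma_transform FT F s \<le> \<mu> * s"
  unfolding sigma_transform_eq
  by (rule T.integral_le_const[OF integrable_sigma_kernel[OF assms]],
      rule eventually_mono[OF T.nonneg])
     (rule sigma_kernel_bounds(2)[OF assms])

text \<open>
  The defect \<open>\<mu> * s - sigma_kernel F \<mu> s t\<close> is the remainder of the transform at \<open>t * s\<close> divided by \<open>t\<close>;
  it is therefore of order \<open>t * s\<^sup>2\<close>, and this factor \<open>t\<close> is how the mean of \<open>T\<close> enters the second moments.
\<close>
lemma sigma_kernel_second_order:
  assumes "0 \<le> t" and pos: "\<And>n. 0 < u n" and lim: "u \<longlonglongrightarrow> 0"
  shows "(\<lambda>n. (\<mu> * u n - sigma_kernel F \<mu> (u n) t) / (u n)\<^sup>2) \<longlonglongrightarrow> X.m2 / 2 * t"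
proof (cases "t = 0")
  case False
  with \<open>0 \<le> t\<close> have "0 < t" by simp
  have "(\<lambda>n. (laplace_stieltjes F (t * u n) - 1 + \<mu> * (t * u n)) / (t * u n)\<^sup>2 * t) \<longlonglongrightarrow> X.m2 / 2 * t"
    using \<open>0 < t\<close> pos tendsto_mult_right_zero[OF lim]
    by (intro tendsto_mult tendsto_const X.laplace_second_order) auto
  moreover have "(laplace_stieltjes F (t * u n) - 1 + \<mu> * (t * u n)) / (t * u n)\<^sup>2 * t
      = (\<mu> * u n - sigma_kernel F \<mu> (u n) t) / (u n)\<^sup>2" for n
    using \<open>0 < t\<close> pos[of n] by (simp add: sigma_kernel_def field_simps power2_eq_square)
  ultimately show ?thesis by simp
qed (simp add: sigma_kernel_def)

lemma sigma_kernel_defect_bounds: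
  assumes "0 \<le> s" "0 \<le> t"
  shows "0 \<le> \<mu> * s - sigma_kernel F \<mu> s t" "\<mu> * s - sigma_kernel F \<mu> s t \<le> X.m2 / 2 * t * s\<^sup>2"
proof -
  show "0 \<le> \<mu> * s - sigma_kernel F \<mu> s t"
    using sigma_kernel_bounds(2)[OF assms] by simp
  show "\<mu> * s - sigma_kernel F \<mu> s t \<le> X.m2 / 2 * t * s\<^sup>2"
  proof (cases "t = 0")
    case False
    then have "0 < t" using assms by simp
    have "\<mu> * s - sigma_kernel F \<mu> s t = (laplace_stieltjes F (t * s) - 1 + \<mu> * (t * s)) / t"
      using \<open>0 < t\<close> by (simp add: sigma_kernel_def field_simps)
    also have "\<dots> \<le> (X.m2 / 2 * (t * s)\<^sup>2) / t"
      using X.laplace_remainder_le[of "t * s"] assms \<open>0 < t\<close> by (intro divide_right_mono) auto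
    also have "\<dots> = X.m2 / 2 * t * s\<^sup>2"
      using \<open>0 < t\<close> by (simp add: power2_eq_square)
    finally show ?thesis .
  qed (simp add: sigma_kernel_def)
qed

end

section \<open>Second moments of a law with exponent \<sigma>\<close>

text \<open>
  The second cumulant at \<open>0\<close>: with \<open>x = laplace_stieltjes G u - 1\<close>, the term \<open>ln (1 + x) - x\<close>
  contributes \<open>- \<mu>\<^sup>2 / 2\<close> and \<open>x + \<mu> * u\<close> contributes half the second moment.
\<close>
lemma ln_laplace_second_order:
  assumes "second_order_law G \<mu>" and pos: "\<And>n. 0 < u n" and lim: "u \<longlonglongrightarrow> 0"
  shows "(\<lambda>n. (\<mu> * u n + ln (laplace_stieltjes G (u n))) / (u n)\<^sup>2)
           \<longlonglongrightarrow> ((LINT x|G. x\<^sup>2) - \<mu>\<^sup>2) / 2"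
proof -
  interpret second_order_law G \<mu> by fact
  define x where "x n = laplace_stieltjes G (u n) - 1" for n
  \<comment> \<open>The value at \<open>0\<close> makes \<open>R\<close> continuous there, so \<open>R (x n)\<close> converges to it.\<close>
  define R where "R v = (if v = 0 then - 1 / 2 else (ln (1 + v) - v) / v\<^sup>2)" for v :: real
  have r: "(\<lambda>n. (x n + \<mu> * u n) / (u n)\<^sup>2) \<longlonglongrightarrow> m2 / 2"
    using laplace_second_order[OF pos lim] by (simp add: x_def)
  have "(\<lambda>n. (x n + \<mu> * u n) / (u n)\<^sup>2 * u n - \<mu>) \<longlonglongrightarrow> m2 / 2 * 0 - \<mu>"
    by (intro tendsto_intros r lim)
  then have quot: "(\<lambda>n. x n / u n) \<longlonglongrightarrow> - \<mu>"
    using pos[THEN less_imp_neq] by (simp add: field_simps power2_eq_square)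
  have "(\<lambda>n. x n / u n * u n) \<longlonglongrightarrow> - \<mu> * 0"
    by (intro tendsto_mult quot lim)
  then have x0: "x \<longlonglongrightarrow> 0"
    using pos[THEN less_imp_neq] by (simp add: field_simps)
  have "((\<lambda>v::real. (ln (1 + v) - v) / v\<^sup>2) \<longlongrightarrow> - 1 / 2) (at 0)"
    by real_asymp
  then have "(R \<longlongrightarrow> - 1 / 2) (at 0)"
    by (subst LIM_equal) (auto simp: R_def)
  then have "isCont R 0"
    by (simp add: isCont_def R_def)
  from isCont_tendsto_compose[OF this x0] have R: "(\<lambda>n. R (x n)) \<longlonglongrightarrow> - 1 / 2"
    by (simp add: R_def)
  have "(\<lambda>n. R (x n) * (x n / u n)\<^sup>2 + (x n + \<mu> * u n) / (u n)\<^sup>2)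
      \<longlonglongrightarrow> - 1 / 2 * (- \<mu>)\<^sup>2 + m2 / 2"
    by (intro tendsto_intros R quot r)
  moreover have "R (x n) * (x n / u n)\<^sup>2 + (x n + \<mu> * u n) / (u n)\<^sup>2
      = (\<mu> * u n + ln (laplace_stieltjes G (u n))) / (u n)\<^sup>2" for n
  proof -
    have "R (x n) * (x n)\<^sup>2 = ln (1 + x n) - x n"
      by (simp add: R_def)
    then have "R (x n) * (x n / u n)\<^sup>2 = (ln (1 + x n) - x n) / (u n)\<^sup>2"
      by (simp add: power_divide)
    then show ?thesis
      by (simp add: add_divide_distrib[symmetric] x_def)
  qed
  ultimately show ?thesis by (simp add: diff_divide_distrib)
qed

context transform_setting
begin

text \<open>
  Integrating the second-order expansion of the kernel against the law of \<open>T\<close> and comparing with the second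
  cumulant of \<open>G\<close> gives \<open>E T * m2(F) = Var G\<close>. The limit of the integrals is known to exist because
  \<open>G\<close> has a finite second moment, so Fatou's lemma first yields integrability of \<open>T\<close>; then
  dominated convergence turns the inequality into an equality.
\<close>
lemma second_moment_relation:
  assumes G: "second_order_law G \<mu>" and "0 < \<mu>"
    and eq: "\<And>s. 0 \<le> s \<Longrightarrow> laplace_stieltjes G s = exp (- sigma_transform FT F s)"
  shows "integrable FT (\<lambda>t. t)" and "X.m2 * T.expectation (\<lambda>t. t) = (LINT x|G. x\<^sup>2) - \<mu>\<^sup>2"
proof -
  define u where "u n = 1 / real (Suc n)" for n
  have pos: "0 < u n" for n by (simp add: u_def)
  have lim: "u \<longlonglongrightarrow> 0"
    using LIMSEQ_inverse_real_of_nat by (simp add: u_def[abs_def] inverse_eq_divide)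
  define h where "h n t = (\<mu> * u n - sigma_kernel F \<mu> (u n) t) / (u n)\<^sup>2" for n t
  have int: "integrable FT (h n)" for n
    unfolding h_def using integrable_sigma_kernel[of "u n"] pos[of n] by auto
  have "T.expectation (h n) = (\<mu> * u n + ln (laplace_stieltjes G (u n))) / (u n)\<^sup>2" for n
    using integrable_sigma_kernel[of "u n"] pos[of n] eq[of "u n"] T.prob_space
    by (simp add: h_def[abs_def] sigma_transform_eq)
  then have Eh: "(\<lambda>n. T.expectation (h n)) \<longlonglongrightarrow> ((LINT x|G. x\<^sup>2) - \<mu>\<^sup>2) / 2"
    using ln_laplace_second_order[OF G pos lim] by simp
  have conv: "AE t in FT. (\<lambda>n. h n t) \<longlonglongrightarrow> X.m2 / 2 * t"
    unfolding h_def
    by (rule eventually_mono[OF T.nonneg]) (rule sigma_kernel_second_order[OF _ pos lim])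
  have bnd: "AE t in FT. norm (h n t) \<le> X.m2 / 2 * t" for n
  proof (rule eventually_mono[OF T.nonneg])
    fix t :: real assume "0 \<le> t"
    then show "norm (h n t) \<le> X.m2 / 2 * t"
      using sigma_kernel_defect_bounds[of "u n" t] pos[of n]
      by (simp add: h_def divide_simps)
  qed
  have nn: "AE t in FT. 0 \<le> h n t" for n
  proof (rule eventually_mono[OF T.nonneg])
    fix t :: real assume "0 \<le> t"
    then show "0 \<le> h n t"
      using sigma_kernel_defect_bounds(1)[of "u n" t] pos[of n] by (simp add: h_def)
  qed
  have "0 < \<mu>\<^sup>2" using \<open>0 < \<mu>\<close> by simp
  then have "0 < X.m2" using X.mean_square_le_m2 by linarith
  have "integrable FT (\<lambda>t. X.m2 / 2 * t)"
    using integral_le_of_tendsto[OF int _ nn conv order_refl Eh] by simp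
  then have "integrable FT (\<lambda>t. 2 / X.m2 * (X.m2 / 2 * t))"
    by (rule integrable_mult_right)
  then show iT: "integrable FT (\<lambda>t. t)"
    using \<open>0 < X.m2\<close> by simp
  have "(\<lambda>n. T.expectation (h n)) \<longlonglongrightarrow> T.expectation (\<lambda>t. X.m2 / 2 * t)"
  proof (rule integral_dominated_convergence[OF _ _ _ conv bnd])
    show "h n \<in> borel_measurable FT" for n using int by blast
    show "integrable FT (\<lambda>t. X.m2 / 2 * t)" using iT by simp
  qed simp
  from LIMSEQ_unique[OF this Eh]
  show "X.m2 * T.expectation (\<lambda>t. t) = (LINT x|G. x\<^sup>2) - \<mu>\<^sup>2" by simp
qed

section \<open>Uniqueness by contraction\<close>

text \<open>
  In the weighted distance \<open>sup |L F u - L G u| / u\<^sup>2\<close> the map from a law to its exponent has Lipschitz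
  constant \<open>E T\<close>: the kernel evaluates the transforms at \<open>t * s\<close> and divides by \<open>t\<close>, leaving one factor \<open>t\<close>.
\<close>
lemma sigma_transform_diff_le:
  assumes Y: "second_order_law G \<mu>" and iT: "integrable FT (\<lambda>t. t)" and s: "0 \<le> s"
    and close: "\<And>u. 0 \<le> u \<Longrightarrow> \<bar>laplace_stieltjes F u - laplace_stieltjes G u\<bar> \<le> D * u\<^sup>2"
  shows "\<bar>sigma_transform FT F s - sigma_transform FT G s\<bar> \<le> D * T.expectation (\<lambda>t. t) * s\<^sup>2"
proof -
  interpret Y: transform_setting FT G \<mu>
    using Y by (simp add: transform_setting_def T.nonneg_law_axioms)
  have "\<bar>sigma_transform FT F s - sigma_transform FT G s\<bar>
      = \<bar>T.expectation (\<lambda>t. sigma_kernel F \<mu> s t - sigma_kernel G \<mu> s t)\<bar>"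
    using integrable_sigma_kernel[OF s] Y.integrable_sigma_kernel[OF s]
    by (simp add: sigma_transform_eq Y.sigma_transform_eq)
  also have "\<dots> \<le> T.expectation (\<lambda>t. \<bar>sigma_kernel F \<mu> s t - sigma_kernel G \<mu> s t\<bar>)"
    by (rule integral_abs_bound)
  also have "\<dots> \<le> T.expectation (\<lambda>t. D * s\<^sup>2 * t)"
  proof (rule integral_mono_AE)
    show "AE t in FT. \<bar>sigma_kernel F \<mu> s t - sigma_kernel G \<mu> s t\<bar> \<le> D * s\<^sup>2 * t"
    proof (rule eventually_mono[OF T.nonneg])
      fix t :: real assume "0 \<le> t"
      show "\<bar>sigma_kernel F \<mu> s t - sigma_kernel G \<mu> s t\<bar> \<le> D * s\<^sup>2 * t"
      proof (cases "t = 0")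
        case False
        with \<open>0 \<le> t\<close> have "0 < t" by simp
        have "sigma_kernel F \<mu> s t - sigma_kernel G \<mu> s t
            = - ((laplace_stieltjes F (t * s) - laplace_stieltjes G (t * s)) / t)"
          using \<open>0 < t\<close> by (simp add: sigma_kernel_def diff_divide_distrib)
        also have "\<bar>\<dots>\<bar> = \<bar>laplace_stieltjes F (t * s) - laplace_stieltjes G (t * s)\<bar> / t"
          using \<open>0 < t\<close> by simp
        also have "\<dots> \<le> D * (t * s)\<^sup>2 / t"
          using close[of "t * s"] s \<open>0 < t\<close> by (intro divide_right_mono) auto
        also have "\<dots> = D * s\<^sup>2 * t"
          using \<open>0 < t\<close> by (simp add: power2_eq_square)
        finally show ?thesis .
      qed (simp add: sigma_kernel_def)
    qed
  qed (use iT integrable_sigma_kernel[OF s] Y.integrable_sigma_kernel[OF s] in auto)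
  also have "\<dots> = D * T.expectation (\<lambda>t. t) * s\<^sup>2" by simp
  finally show ?thesis .
qed

end

lemma exp_minus_lipschitz:
  fixes a b :: real
  assumes "0 \<le> a" "0 \<le> b"
  shows "\<bar>exp (- a) - exp (- b)\<bar> \<le> \<bar>a - b\<bar>"
proof -
  have *: "exp (- x) - exp (- y) \<le> y - x" if "0 \<le> x" "x \<le> y" for x y :: real
  proof -
    have "exp (- x) - exp (- y) = exp (- x) * (1 - exp (- (y - x)))"
      by (simp add: right_diff_distrib exp_add[symmetric])
    also have "\<dots> \<le> 1 * (y - x)"
    proof (rule mult_mono)
      show "1 - exp (- (y - x)) \<le> y - x"
        using exp_ge_add_one_self[of "- (y - x)"] by linarith
    qed (use that in auto)
    finally show ?thesis by simp
  qed
  show ?thesis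
    using *[of a b] *[of b a] assms by (cases "a \<le> b") (auto simp: abs_if)
qed

text \<open>
  The weighted distance of two laws with the same mean and finite second moments is finite, because
  their terms of first order cancel; each use of the equation multiplies the bound by \<open>q = E T < 1\<close>.
\<close>
lemma solution_unique:
  assumes F: "second_order_law F \<mu>" and G: "second_order_law G \<mu>" and FT: "nonneg_law FT"
    and solF: "\<And>s. 0 \<le> s \<Longrightarrow> laplace_stieltjes F s = exp (- sigma_transform FT F s)"
    and solG: "\<And>s. 0 \<le> s \<Longrightarrow> laplace_stieltjes G s = exp (- sigma_transform FT G s)"
    and iT: "integrable FT (\<lambda>t. t)" and lt: "(LINT t|FT. t) < 1"
  shows "F = G"
proof -
  interpret transform_setting FT F \<mu> using F FT by (simp add: transform_setting_def)
  interpret Y: transform_setting FT G \<mu> using G FT by (simp add: transform_setting_def)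
  define q where "q = T.expectation (\<lambda>t. t)"
  define C where "C = (X.m2 + Y.X.m2) / 2"
  have q: "0 \<le> q" "q < 1"
    using integral_nonneg_AE[OF T.nonneg] lt by (auto simp: q_def)
  have bound: "\<bar>laplace_stieltjes F s - laplace_stieltjes G s\<bar> \<le> C * q ^ k * s\<^sup>2" if "0 \<le> s" for k s
    using that
  proof (induction k arbitrary: s)
    case 0
    have "0 \<le> X.m2 / 2 * s\<^sup>2" "0 \<le> Y.X.m2 / 2 * s\<^sup>2" by simp_all
    moreover have "C * q ^ 0 * s\<^sup>2 = X.m2 / 2 * s\<^sup>2 + Y.X.m2 / 2 * s\<^sup>2"
      by (simp add: C_def algebra_simps)
    ultimately show ?case
      using X.laplace_remainder_nonneg[OF 0] X.laplace_remainder_le[OF 0]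
        Y.X.laplace_remainder_nonneg[OF 0] Y.X.laplace_remainder_le[OF 0] by linarith
  next
    case (Suc k)
    have "\<bar>laplace_stieltjes F s - laplace_stieltjes G s\<bar>
        \<le> \<bar>sigma_transform FT F s - sigma_transform FT G s\<bar>"
      unfolding solF[OF Suc.prems] solG[OF Suc.prems]
      using exp_minus_lipschitz sigma_transform_nonneg Y.sigma_transform_nonneg Suc.prems by blast
    also have "\<dots> \<le> C * q ^ k * q * s\<^sup>2"
      unfolding q_def by (rule sigma_transform_diff_le[OF G iT Suc.prems]) (use Suc.IH q_def in simp)
    finally show ?case by (simp add: mult_ac)
  qed
  have "laplace_stieltjes F s = laplace_stieltjes G s" if s: "0 \<le> s" for s
  proof -
    have "(\<lambda>k. C * q ^ k * s\<^sup>2) \<longlonglongrightarrow> C * 0 * s\<^sup>2"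
      using q by (intro tendsto_intros LIMSEQ_realpow_zero) auto
    then have "\<bar>laplace_stieltjes F s - laplace_stieltjes G s\<bar> \<le> C * 0 * s\<^sup>2"
      by (rule LIMSEQ_le_const) (use bound[OF s] in auto)
    then show ?thesis by simp
  qed
  then show ?thesis
    by (intro laplace_unique X.nonneg_law_axioms Y.X.nonneg_law_axioms) simp
qed

section \<open>Convolution powers\<close>

lemma second_order_lawI:
  assumes "prob_space G" and sets: "sets G = sets borel" and nonneg: "AE x in G. 0 \<le> x"
    and id: "has_bochner_integral G (\<lambda>x. x) m" and sq: "has_bochner_integral G (\<lambda>x. x\<^sup>2) v"
  shows "second_order_law G m" and "(LINT x|G. x\<^sup>2) = v"
proof -
  interpret prob_space G by fact
  show "second_order_law G m"
    using sets nonneg id sq by unfold_locales (auto simp: has_bochner_integral_iff)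
  show "(LINT x|G. x\<^sup>2) = v" using sq by (simp add: has_bochner_integral_iff)
qed

lemma AE_nonneg_of_nn_integral:
  assumes "sets G = sets borel" and "(\<integral>\<^sup>+x. indicator {..<0::real} x \<partial>G) = 0"
  shows "AE x in G. 0 \<le> x"
proof -
  have [measurable_cong]: "sets G = sets borel" by fact
  have "AE x in G. indicator {..<0::real} x = (0::ennreal)"
    using assms(2) by (subst nn_integral_0_iff_AE[symmetric]) auto
  then show ?thesis
    by eventually_elim (auto simp: indicator_def split: if_splits)
qed

context
  fixes F G :: "real measure"
  assumes F: "nonneg_law F" and G: "nonneg_law G"
begin

interpretation F: nonneg_law F by (rule F)
interpretation G: nonneg_law G by (rule G)

lemma nn_integral_convolution_laws:
  assumes "f \<in> borel_measurable borel"
  shows "(\<integral>\<^sup>+x. f x \<partial>(F \<star> G)) = (\<integral>\<^sup>+x. \<integral>\<^sup>+y. f (x + y) \<partial>G \<partial>F)"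
  using assms by (intro nn_integral_convolution F.finite_measure_axioms G.finite_measure_axioms) auto

lemma convolution_nonneg: "AE x in F \<star> G. 0 \<le> x"
proof (rule AE_nonneg_of_nn_integral)
  have "(\<integral>\<^sup>+x. indicator {..<0} x \<partial>(F \<star> G)) = (\<integral>\<^sup>+x. \<integral>\<^sup>+y. indicator {..<0} (x + y) \<partial>G \<partial>F)"
    by (rule nn_integral_convolution_laws) simp
  also have "\<dots> = (\<integral>\<^sup>+x. 0 \<partial>F)"
  proof (rule nn_integral_cong_AE, rule eventually_mono[OF F.nonneg])
    fix x :: real assume "0 \<le> x"
    have "(\<integral>\<^sup>+y. indicator {..<0} (x + y) \<partial>G) = (\<integral>\<^sup>+y. 0 \<partial>G)"
      by (rule nn_integral_cong_AE, rule eventually_mono[OF G.nonneg]) (use \<open>0 \<le> x\<close> in auto)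
    then show "(\<integral>\<^sup>+y. indicator {..<0} (x + y) \<partial>G) = 0" by simp
  qed
  finally show "(\<integral>\<^sup>+x. indicator {..<0} x \<partial>(F \<star> G)) = 0" by simp
qed simp

text \<open>
  Mean, second moment and transform all integrate functions that are nonnegative on the half-line,
  so iterated integration is justified by Tonelli and integrability comes out for free.
\<close>
lemma has_bochner_integral_convolution:
  fixes h g :: "real \<Rightarrow> real"
  assumes [measurable]: "h \<in> borel_measurable borel" and h: "\<And>x. 0 \<le> x \<Longrightarrow> 0 \<le> h x"
    and inner: "\<And>x. 0 \<le> x \<Longrightarrow> has_bochner_integral G (\<lambda>y. h (x + y)) (g x)"
    and g: "has_bochner_integral F g c"
  shows "has_bochner_integral (F \<star> G) h c"
proof -
  have ae: "AE y in G. 0 \<le> h (x + y)" if "0 \<le> x" for x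
    by (rule eventually_mono[OF G.nonneg]) (use h that in auto)
  have g_nonneg: "0 \<le> g x" if "0 \<le> x" for x
    using integral_nonneg_AE[OF ae[OF that]] inner[OF that] by (simp add: has_bochner_integral_iff)
  have aeg: "AE x in F. 0 \<le> g x"
    by (rule eventually_mono[OF F.nonneg]) (rule g_nonneg)
  have "(\<integral>\<^sup>+x. ennreal (h x) \<partial>(F \<star> G)) = (\<integral>\<^sup>+x. \<integral>\<^sup>+y. ennreal (h (x + y)) \<partial>G \<partial>F)"
    by (rule nn_integral_convolution_laws) simp
  also have "\<dots> = (\<integral>\<^sup>+x. ennreal (g x) \<partial>F)"
  proof (rule nn_integral_cong_AE, rule eventually_mono[OF F.nonneg])
    fix x :: real assume "0 \<le> x"
    then show "(\<integral>\<^sup>+y. ennreal (h (x + y)) \<partial>G) = ennreal (g x)"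
      using inner[OF \<open>0 \<le> x\<close>] nn_integral_eq_integral[OF _ ae[OF \<open>0 \<le> x\<close>]]
      by (simp add: has_bochner_integral_iff)
  qed
  also have "\<dots> = ennreal c"
    using g nn_integral_eq_integral[OF _ aeg] by (simp add: has_bochner_integral_iff)
  finally have "(\<integral>\<^sup>+x. ennreal (h x) \<partial>(F \<star> G)) = ennreal c" .
  moreover have "AE x in F \<star> G. 0 \<le> h x"
    by (rule eventually_mono[OF convolution_nonneg]) (rule h)
  moreover have "0 \<le> c"
    using integral_nonneg_AE[OF aeg] g by (simp add: has_bochner_integral_iff)
  ultimately show ?thesis
    by (intro has_bochner_integral_nn_integral) auto
qed

end

lemma convolution_law:
  assumes "second_order_law F m" and "second_order_law G m'"
  shows "second_order_law (F \<star> G) (m + m')"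
    and "(LINT x|(F \<star> G). x\<^sup>2) = (LINT x|F. x\<^sup>2) + 2 * m * m' + (LINT x|G. x\<^sup>2)"
    and "\<And>s. 0 \<le> s \<Longrightarrow> laplace_stieltjes (F \<star> G) s = laplace_stieltjes F s * laplace_stieltjes G s"
proof -
  interpret F: second_order_law F m by fact
  interpret G: second_order_law G m' by fact
  note conv = has_bochner_integral_convolution[OF F.nonneg_law_axioms G.nonneg_law_axioms]
  have prob: "prob_space (F \<star> G)"
  proof -
    interpret P: pair_prob_space F G ..
    show ?thesis unfolding convolution_def by (rule P.prob_space_distr) simp
  qed
  have nonneg: "AE x in F \<star> G. 0 \<le> x"
    by (rule convolution_nonneg[OF F.nonneg_law_axioms G.nonneg_law_axioms])
  have id: "has_bochner_integral (F \<star> G) (\<lambda>x. x) (m + m')"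
  proof (rule conv)
    show "has_bochner_integral G (\<lambda>y. x + y) (x + m')" for x
      using G.integrable_id G.mean G.prob_space by (simp add: has_bochner_integral_iff)
    show "has_bochner_integral F (\<lambda>x. x + m') (m + m')"
      using F.integrable_id F.mean F.prob_space by (simp add: has_bochner_integral_iff)
  qed auto
  have sq: "has_bochner_integral (F \<star> G) (\<lambda>x. x\<^sup>2) (F.m2 + 2 * m * m' + G.m2)"
  proof (rule conv)
    show "has_bochner_integral G (\<lambda>y. (x + y)\<^sup>2) (x\<^sup>2 + 2 * x * m' + G.m2)" for x
    proof -
      have "(\<lambda>y. (x + y)\<^sup>2) = (\<lambda>y. x\<^sup>2 + 2 * x * y + y\<^sup>2)"
        by (simp add: power2_sum ac_simps)
      then show ?thesis
        using G.integrable_id G.integrable_square G.mean G.prob_space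
        by (simp add: has_bochner_integral_iff)
    qed
    show "has_bochner_integral F (\<lambda>x. x\<^sup>2 + 2 * x * m' + G.m2) (F.m2 + 2 * m * m' + G.m2)"
      using F.integrable_id F.integrable_square F.mean F.prob_space
      by (simp add: has_bochner_integral_iff)
  qed auto
  show law: "second_order_law (F \<star> G) (m + m')"
    and "(LINT x|(F \<star> G). x\<^sup>2) = F.m2 + 2 * m * m' + G.m2"
    using second_order_lawI[OF prob _ nonneg id sq] by auto
  interpret FG: second_order_law "F \<star> G" "m + m'" by (rule law)
  fix s :: real assume s: "0 \<le> s"
  have "has_bochner_integral (F \<star> G) (\<lambda>x. exp (- (s * x))) (laplace_stieltjes F s * laplace_stieltjes G s)"
  proof (rule conv)
    show "has_bochner_integral G (\<lambda>y. exp (- (s * (x + y)))) (exp (- (s * x)) * laplace_stieltjes G s)" for x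
      using G.integrable_exp_minus[OF s]
      by (simp add: has_bochner_integral_iff G.laplace_eq distrib_left exp_add exp_diff exp_minus divide_inverse)
    show "has_bochner_integral F (\<lambda>x. exp (- (s * x)) * laplace_stieltjes G s)
        (laplace_stieltjes F s * laplace_stieltjes G s)"
      using F.integrable_exp_minus[OF s] by (simp add: has_bochner_integral_iff F.laplace_eq)
  qed auto
  then show "laplace_stieltjes (F \<star> G) s = laplace_stieltjes F s * laplace_stieltjes G s"
    by (simp add: FG.laplace_eq has_bochner_integral_iff)
qed

lemma point_mass_law:
  assumes "0 \<le> c"
  shows "second_order_law (return borel c) c"
    and "(LINT x|return borel c. x\<^sup>2) = c\<^sup>2"
    and "laplace_stieltjes (return borel c) s = exp (- (s * c))"
proof -
  have prob: "prob_space (return borel c)"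
    by (rule prob_space_return) simp
  have fin: "has_bochner_integral (return borel c) f (f c)"
    if [measurable]: "f \<in> borel_measurable borel" for f :: "real \<Rightarrow> real"
  proof -
    have "integrable (return borel c) f"
      by (rule finite_measure.integrable_const_bound[where B = "\<bar>f c\<bar>"])
         (use prob in \<open>auto simp: AE_return prob_space.finite_measure\<close>)
    then show ?thesis by (simp add: has_bochner_integral_iff integral_return)
  qed
  have nonneg: "AE x in return borel c. 0 \<le> x"
    using assms by (subst AE_return) auto
  show law: "second_order_law (return borel c) c" and "(LINT x|return borel c. x\<^sup>2) = c\<^sup>2"
    by (rule second_order_lawI[OF prob _ nonneg fin fin]; simp)+
  interpret second_order_law "return borel c" c by (rule law)
  show "laplace_stieltjes (return borel c) s = exp (- (s * c))"
    unfolding laplace_eq by (subst integral_return) auto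
qed

lemma convolution_power_law:
  assumes "second_order_law H m"
  shows "\<exists>G. second_order_law G (real k * m)
      \<and> (LINT x|G. x\<^sup>2) = real k * (LINT x|H. x\<^sup>2) + real k * (real k - 1) * m\<^sup>2
      \<and> (\<forall>s\<ge>0. laplace_stieltjes G s = laplace_stieltjes H s ^ k)"
proof (induction k)
  case 0
  show ?case
    using point_mass_law[of 0] by (intro exI[of _ "return borel 0"]) simp
next
  case (Suc k)
  then obtain G where G: "second_order_law G (real k * m)"
    "(LINT x|G. x\<^sup>2) = real k * (LINT x|H. x\<^sup>2) + real k * (real k - 1) * m\<^sup>2"
    "\<forall>s\<ge>0. laplace_stieltjes G s = laplace_stieltjes H s ^ k"
    by blast
  note conv = convolution_law[OF G(1) assms]
  show ?case
  proof (intro exI[of _ "G \<star> H"] conjI allI impI)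
    show "second_order_law (G \<star> H) (real (Suc k) * m)"
      using conv(1) by (simp add: algebra_simps)
    show "(LINT x|(G \<star> H). x\<^sup>2) = real (Suc k) * (LINT x|H. x\<^sup>2) + real (Suc k) * (real (Suc k) - 1) * m\<^sup>2"
      unfolding conv(2) G(2) by (simp add: algebra_simps power2_eq_square)
    show "laplace_stieltjes (G \<star> H) s = laplace_stieltjes H s ^ Suc k" if "0 \<le> s" for s
      using conv(3)[OF that] G(3) that by simp
  qed
qed

section \<open>Existence of a law with exponent \<sigma>\<close>

context transform_setting
begin

text \<open>
  The random variable \<open>B * U * X\<close> with \<open>U = max T (1 / n)\<close>, where, given \<open>T\<close>, the Bernoulli variable
  \<open>B\<close> has parameter \<open>1 / (n * U)\<close> and is realised as \<open>v \<le> 1 / (n * U)\<close> for a uniform \<open>v\<close>. Cutting \<open>T\<close> off at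
  \<open>1 / n\<close> is what makes this parameter at most \<open>1\<close>.
\<close>
definition thinned_value :: "real \<Rightarrow> real \<times> real \<times> real \<Rightarrow> real" where
  "thinned_value n = (\<lambda>(t, x, v). if v \<le> 1 / (n * max t (1 / n)) then max t (1 / n) * x else 0)"

definition thinned_law :: "real \<Rightarrow> real measure" where
  "thinned_law n = distr (FT \<Otimes>\<^sub>M (F \<Otimes>\<^sub>M uniform_measure lborel {0..1})) borel (thinned_value n)"

lemma measurable_thinned_value [measurable]:
  "thinned_value n \<in> borel_measurable (borel \<Otimes>\<^sub>M (borel \<Otimes>\<^sub>M borel))"
  unfolding thinned_value_def by measurable

lemma prob_space_uniform01: "prob_space (uniform_measure lborel {0..1::real})"
  by (rule prob_space_uniform_measure) auto

lemma prob_space_thinned_law: "prob_space (thinned_law n)"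
proof -
  interpret U: prob_space "uniform_measure lborel {0..1::real}" by (rule prob_space_uniform01)
  interpret XU: pair_prob_space F "uniform_measure lborel {0..1::real}" ..
  interpret TXU: pair_prob_space FT "F \<Otimes>\<^sub>M uniform_measure lborel {0..1::real}" ..
  show ?thesis
    unfolding thinned_law_def by (rule TXU.prob_space_distr) measurable
qed

lemma nn_integral_thinned_law:
  fixes h :: "real \<Rightarrow> ennreal"
  assumes "0 < n" and [measurable]: "h \<in> borel_measurable borel" and "h 0 = 0"
  shows "(\<integral>\<^sup>+y. h y \<partial>thinned_law n)
    = (\<integral>\<^sup>+t. \<integral>\<^sup>+x. ennreal (1 / (n * max t (1 / n))) * h (max t (1 / n) * x) \<partial>F \<partial>FT)"
proof -
  let ?U = "uniform_measure lborel {0..1::real}"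
  interpret U: prob_space ?U by (rule prob_space_uniform01)
  interpret XU: pair_prob_space F ?U ..
  interpret TXU: pair_prob_space FT "F \<Otimes>\<^sub>M ?U" ..
  have inner: "(\<integral>\<^sup>+v. h (thinned_value n (t, x, v)) \<partial>?U)
      = ennreal (1 / (n * max t (1 / n))) * h (max t (1 / n) * x)" for t x
  proof -
    define p where "p = 1 / (n * max t (1 / n))"
    have "1 \<le> n * max t (1 / n)"
      using \<open>0 < n\<close> mult_left_mono[of "1 / n" "max t (1 / n)" n] by simp
    then have p: "0 \<le> p" "p \<le> 1" by (auto simp: p_def)
    then have "{0..1} \<inter> {..p} = {0..p}" by auto
    then have "emeasure ?U {..p} = ennreal p"
      using p by (subst emeasure_uniform_measure) (auto simp: divide_ennreal_def)
    moreover have "(\<integral>\<^sup>+v. h (thinned_value n (t, x, v)) \<partial>?U)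
        = (\<integral>\<^sup>+v. h (max t (1 / n) * x) * indicator {..p} v \<partial>?U)"
      by (rule nn_integral_cong) (auto simp: thinned_value_def p_def \<open>h 0 = 0\<close> split: split_indicator)
    moreover have "\<dots> = h (max t (1 / n) * x) * emeasure ?U {..p}"
      by (rule nn_integral_cmult_indicator) simp
    ultimately show ?thesis
      by (simp only: p_def mult.commute)
  qed
  have "(\<integral>\<^sup>+y. h y \<partial>thinned_law n) = (\<integral>\<^sup>+z. h (thinned_value n z) \<partial>(FT \<Otimes>\<^sub>M (F \<Otimes>\<^sub>M ?U)))"
    unfolding thinned_law_def by (rule nn_integral_distr) measurable
  also have "\<dots> = (\<integral>\<^sup>+t. \<integral>\<^sup>+w. h (thinned_value n (t, w)) \<partial>(F \<Otimes>\<^sub>M ?U) \<partial>FT)"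
    by (subst XU.P.nn_integral_fst[symmetric]) measurable
  also have "\<dots> = (\<integral>\<^sup>+t. \<integral>\<^sup>+x. \<integral>\<^sup>+v. h (thinned_value n (t, x, v)) \<partial>?U \<partial>F \<partial>FT)"
    by (intro nn_integral_cong, subst U.nn_integral_fst[symmetric]) measurable
  finally show ?thesis by (simp only: inner)
qed

lemma thinned_law_nonneg:
  assumes "0 < n"
  shows "AE y in thinned_law n. 0 \<le> y"
proof (rule AE_nonneg_of_nn_integral)
  have pos: "0 < max t (1 / n)" for t using assms by (simp add: less_max_iff_disj)
  have "(\<integral>\<^sup>+y. indicator {..<0} y \<partial>thinned_law n)
    = (\<integral>\<^sup>+t. \<integral>\<^sup>+x. ennreal (1 / (n * max t (1 / n))) * indicator {..<0} (max t (1 / n) * x) \<partial>F \<partial>FT)"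
    by (rule nn_integral_thinned_law[OF assms]) auto
  also have "\<dots> = (\<integral>\<^sup>+t. \<integral>\<^sup>+x. 0 \<partial>F \<partial>FT)"
  proof (intro nn_integral_cong nn_integral_cong_AE, rule eventually_mono[OF X.nonneg])
    fix t x :: real assume "0 \<le> x"
    then have "0 \<le> max t (1 / n) * x" using pos[of t] by (intro mult_nonneg_nonneg) auto
    then show "ennreal (1 / (n * max t (1 / n))) * indicator {..<0} (max t (1 / n) * x) = 0"
      by simp
  qed
  finally show "(\<integral>\<^sup>+y. indicator {..<0} y \<partial>thinned_law n) = 0" by simp
qed (simp add: thinned_law_def)

text \<open>
  For functions that vanish at \<open>0\<close> the event \<open>B = 0\<close> does not contribute, so conditioning on \<open>T\<close> only
  multiplies by the Bernoulli parameter. The function \<open>g\<close> is the conditional expectation given \<open>U = u\<close>.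
\<close>
lemma has_bochner_integral_thinned_law:
  fixes h g :: "real \<Rightarrow> real"
  assumes n: "0 < n" and [measurable]: "h \<in> borel_measurable borel"
    and h: "\<And>x. 0 \<le> x \<Longrightarrow> 0 \<le> h x" "h 0 = 0"
    and inner: "\<And>u. 0 < u \<Longrightarrow> has_bochner_integral F (\<lambda>x. h (u * x)) (n * u * g u)"
    and g: "has_bochner_integral FT (\<lambda>t. g (max t (1 / n))) c"
  shows "has_bochner_integral (thinned_law n) h c"
proof -
  have pos: "0 < max t (1 / n)" for t using n by (simp add: less_max_iff_disj)
  have ae: "AE x in F. 0 \<le> h (u * x)" if "0 < u" for u
    by (rule eventually_mono[OF X.nonneg]) (use h that in auto)
  have g_nonneg: "0 \<le> g u" if "0 < u" for u
  proof -
    have "0 \<le> n * u * g u"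
      using integral_nonneg_AE[OF ae[OF that]] inner[OF that] by (simp add: has_bochner_integral_iff)
    moreover have "0 < n * u" using n that by simp
    ultimately show ?thesis by (simp only: zero_le_mult_iff) linarith
  qed
  have "(\<integral>\<^sup>+y. ennreal (h y) \<partial>thinned_law n)
    = (\<integral>\<^sup>+t. \<integral>\<^sup>+x. ennreal (1 / (n * max t (1 / n))) * ennreal (h (max t (1 / n) * x)) \<partial>F \<partial>FT)"
    by (rule nn_integral_thinned_law[OF n]) (auto simp: h)
  also have "\<dots> = (\<integral>\<^sup>+t. ennreal (g (max t (1 / n))) \<partial>FT)"
  proof (rule nn_integral_cong)
    fix t :: real
    define u where "u = max t (1 / n)"
    have u: "0 < u" using pos by (simp add: u_def)
    have "(\<integral>\<^sup>+x. ennreal (1 / (n * u)) * ennreal (h (u * x)) \<partial>F)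
        = ennreal (1 / (n * u)) * ennreal (n * u * g u)"
      using inner[OF u] nn_integral_eq_integral[OF _ ae[OF u]]
      by (simp add: nn_integral_cmult has_bochner_integral_iff)
    also have "\<dots> = ennreal (g u)"
      using u n g_nonneg[OF u] by (subst ennreal_mult[symmetric]) auto
    finally show "(\<integral>\<^sup>+x. ennreal (1 / (n * max t (1 / n))) * ennreal (h (max t (1 / n) * x)) \<partial>F)
        = ennreal (g (max t (1 / n)))" by (simp add: u_def)
  qed
  also have "\<dots> = ennreal c"
    using g nn_integral_eq_integral[of FT "\<lambda>t. g (max t (1 / n))"] g_nonneg[OF pos]
    by (simp add: has_bochner_integral_iff)
  finally have "(\<integral>\<^sup>+y. ennreal (h y) \<partial>thinned_law n) = ennreal c" .
  moreover have "AE y in thinned_law n. 0 \<le> h y"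
    by (rule eventually_mono[OF thinned_law_nonneg[OF n]]) (rule h)
  moreover have "0 \<le> c"
    using g g_nonneg[OF pos] by (auto simp: has_bochner_integral_iff intro: integral_nonneg_AE)
  ultimately show ?thesis
    by (intro has_bochner_integral_nn_integral) (auto simp: thinned_law_def)
qed

lemma integrable_truncated_kernel:
  assumes "0 < n" "0 \<le> s"
  shows "integrable FT (\<lambda>t. sigma_kernel F \<mu> s (max t (1 / n)))"
proof (rule T.integrable_const_bound[where B = "\<mu> * s"])
  show "AE t in FT. norm (sigma_kernel F \<mu> s (max t (1 / n))) \<le> \<mu> * s"
    using sigma_kernel_bounds[OF assms(2)] assms(1)
    by (intro AE_I2) (simp add: le_max_iff_disj)
qed measurable

text \<open>
  The Bernoulli parameter cancels one factor \<open>U\<close>: the mean is exactly \<open>\<mu> / n\<close>, the second moment is of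
  order \<open>1 / n\<close>, and \<open>1 -\<close> the transform is one \<open>n\<close>-th of the exponent with \<open>T\<close> replaced by \<open>U\<close>.
\<close>
lemma thinned_law_moments:
  assumes n: "0 < n" and iT: "integrable FT (\<lambda>t. t)"
  shows "second_order_law (thinned_law n) (\<mu> / n)"
    and "(LINT y|thinned_law n. y\<^sup>2) = X.m2 / n * T.expectation (\<lambda>t. max t (1 / n))"
    and "\<And>s. 0 \<le> s \<Longrightarrow> laplace_stieltjes (thinned_law n) s
          = 1 - T.expectation (\<lambda>t. sigma_kernel F \<mu> s (max t (1 / n))) / n"
proof -
  have id: "has_bochner_integral (thinned_law n) (\<lambda>y. y) (\<mu> / n)"
  proof (rule has_bochner_integral_thinned_law[OF n, where g = "\<lambda>_. \<mu> / n"])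
    show "has_bochner_integral F (\<lambda>x. u * x) (n * u * (\<mu> / n))" for u
      using X.integrable_id X.mean n by (simp add: has_bochner_integral_iff)
    show "has_bochner_integral FT (\<lambda>_. \<mu> / n) (\<mu> / n)"
      using T.prob_space by (simp add: has_bochner_integral_iff)
  qed auto
  have sq: "has_bochner_integral (thinned_law n) (\<lambda>y. y\<^sup>2) (X.m2 / n * T.expectation (\<lambda>t. max t (1 / n)))"
  proof (rule has_bochner_integral_thinned_law[OF n, where g = "\<lambda>u. X.m2 / n * u"])
    show "has_bochner_integral F (\<lambda>x. (u * x)\<^sup>2) (n * u * (X.m2 / n * u))" for u
      using X.integrable_square n
      by (simp add: has_bochner_integral_iff power_mult_distrib power2_eq_square[of u])
    show "has_bochner_integral FT (\<lambda>t. X.m2 / n * max t (1 / n)) (X.m2 / n * T.expectation (\<lambda>t. max t (1 / n)))"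
      using iT by (simp add: has_bochner_integral_iff)
  qed auto
  show law: "second_order_law (thinned_law n) (\<mu> / n)"
    and "(LINT y|thinned_law n. y\<^sup>2) = X.m2 / n * T.expectation (\<lambda>t. max t (1 / n))"
    using second_order_lawI[OF prob_space_thinned_law _ thinned_law_nonneg[OF n] id sq]
    by (auto simp: thinned_law_def)
  interpret H: second_order_law "thinned_law n" "\<mu> / n" by (rule law)
  fix s :: real assume s: "0 \<le> s"
  have "has_bochner_integral (thinned_law n) (\<lambda>y. 1 - exp (- (s * y)))
      (T.expectation (\<lambda>t. sigma_kernel F \<mu> s (max t (1 / n))) / n)"
  proof (rule has_bochner_integral_thinned_law[OF n, where g = "\<lambda>u. sigma_kernel F \<mu> s u / n"])
    show "has_bochner_integral F (\<lambda>x. 1 - exp (- (s * (u * x)))) (n * u * (sigma_kernel F \<mu> s u / n))"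
      if "0 < u" for u
      using X.integrable_exp_minus[of "u * s"] s that n X.prob_space
      by (simp add: has_bochner_integral_iff sigma_kernel_def X.laplace_eq mult_ac)
    show "has_bochner_integral FT (\<lambda>t. sigma_kernel F \<mu> s (max t (1 / n)) / n)
        (T.expectation (\<lambda>t. sigma_kernel F \<mu> s (max t (1 / n))) / n)"
      using integrable_truncated_kernel[OF n s] by (simp add: has_bochner_integral_iff)
  qed (use s in auto)
  then show "laplace_stieltjes (thinned_law n) s
      = 1 - T.expectation (\<lambda>t. sigma_kernel F \<mu> s (max t (1 / n))) / n"
    using H.integrable_exp_minus[OF s] H.prob_space
    by (simp add: has_bochner_integral_iff H.laplace_eq)
qed

lemma truncated_sigma_tendsto:
  assumes s: "0 \<le> s"
  shows "(\<lambda>k. T.expectation (\<lambda>t. sigma_kernel F \<mu> s (max t (1 / real (Suc k)))))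
           \<longlonglongrightarrow> sigma_transform FT F s"
  unfolding sigma_transform_eq
proof (rule integral_dominated_convergence[where w = "\<lambda>_. \<mu> * s"])
  have u0: "(\<lambda>k. 1 / real (Suc k)) \<longlonglongrightarrow> 0"
    using LIMSEQ_inverse_real_of_nat by (simp add: inverse_eq_divide)
  show "AE t in FT. (\<lambda>k. sigma_kernel F \<mu> s (max t (1 / real (Suc k)))) \<longlonglongrightarrow> sigma_kernel F \<mu> s t"
  proof (rule eventually_mono[OF T.nonneg])
    fix t :: real assume "0 \<le> t"
    show "(\<lambda>k. sigma_kernel F \<mu> s (max t (1 / real (Suc k)))) \<longlonglongrightarrow> sigma_kernel F \<mu> s t"
    proof (cases "t = 0")
      case True
      have "(\<lambda>k. \<mu> * s - X.m2 / 2 * (1 / real (Suc k)) * s\<^sup>2) \<longlonglongrightarrow> \<mu> * s - X.m2 / 2 * 0 * s\<^sup>2"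
        by (intro tendsto_intros u0)
      then have lower: "(\<lambda>k. \<mu> * s - X.m2 / 2 * (1 / real (Suc k)) * s\<^sup>2) \<longlonglongrightarrow> \<mu> * s"
        by simp
      have "(\<lambda>k. sigma_kernel F \<mu> s (1 / real (Suc k))) \<longlonglongrightarrow> \<mu> * s"
      proof (rule tendsto_sandwich[OF _ _ lower tendsto_const])
        show "\<forall>\<^sub>F k in sequentially. \<mu> * s - X.m2 / 2 * (1 / real (Suc k)) * s\<^sup>2
            \<le> sigma_kernel F \<mu> s (1 / real (Suc k))"
        proof (intro always_eventually allI)
          fix k
          show "\<mu> * s - X.m2 / 2 * (1 / real (Suc k)) * s\<^sup>2 \<le> sigma_kernel F \<mu> s (1 / real (Suc k))"
            using sigma_kernel_defect_bounds(2)[OF s, of "1 / real (Suc k)"] by simp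
        qed
        show "\<forall>\<^sub>F k in sequentially. sigma_kernel F \<mu> s (1 / real (Suc k)) \<le> \<mu> * s"
          by (intro always_eventually allI sigma_kernel_bounds(2)[OF s]) simp
      qed
      then show ?thesis using True by (simp add: sigma_kernel_def max_def)
    next
      case False
      with \<open>0 \<le> t\<close> have "0 < t" by simp
      from order_tendstoD(2)[OF u0 this]
      have "\<forall>\<^sub>F k in sequentially. sigma_kernel F \<mu> s (max t (1 / real (Suc k))) = sigma_kernel F \<mu> s t"
        by eventually_elim (simp add: max_absorb1)
      then show ?thesis by (rule tendsto_eventually)
    qed
  qed
  show "AE t in FT. norm (sigma_kernel F \<mu> s (max t (1 / real (Suc k)))) \<le> \<mu> * s" for k
    using sigma_kernel_bounds[OF s] by (intro AE_I2) (simp add: le_max_iff_disj)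
qed auto

end

text \<open>
  The numerators vary with \<open>k\<close>. On \<open>[-1,1]\<close> the map \<open>a \<mapsto> a ^ k\<close> has Lipschitz constant \<open>k\<close>, which
  cancels the denominator, so they may be replaced by their limit.
\<close>
lemma one_minus_div_power_tendsto_exp:
  fixes x :: "nat \<Rightarrow> real"
  assumes lim: "x \<longlonglongrightarrow> c" and x: "\<And>k. 0 \<le> 1 - x k / real (Suc k)" "\<And>k. 0 \<le> x k"
  shows "(\<lambda>k. (1 - x k / real (Suc k)) ^ Suc k) \<longlonglongrightarrow> exp (- c)"
proof -
  have "0 \<le> c" by (rule LIMSEQ_le_const[OF lim]) (use x in auto)
  have base: "(\<lambda>k. (1 - c / real (Suc k)) ^ Suc k) \<longlonglongrightarrow> exp (- c)"
    using LIMSEQ_Suc[OF tendsto_exp_limit_sequentially[of "- c"]] by simp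
  have "(\<lambda>k. (1 - x k / real (Suc k)) ^ Suc k - (1 - c / real (Suc k)) ^ Suc k) \<longlonglongrightarrow> 0"
  proof (rule Lim_null_comparison)
    obtain N where N: "c \<le> real N" using real_arch_simple by blast
    show "\<forall>\<^sub>F k in sequentially.
        norm ((1 - x k / real (Suc k)) ^ Suc k - (1 - c / real (Suc k)) ^ Suc k) \<le> \<bar>x k - c\<bar>"
    proof (rule eventually_sequentiallyI[of N])
      fix k assume "N \<le> k"
      then have ck: "c \<le> real (Suc k)" using N by simp
      have "norm ((1 - x k / real (Suc k)) ^ Suc k - (1 - c / real (Suc k)) ^ Suc k)
          \<le> real (Suc k) * norm ((1 - x k / real (Suc k)) - (1 - c / real (Suc k)))"
        by (rule norm_power_diff) (use x[of k] ck \<open>0 \<le> c\<close> in \<open>simp_all add: abs_le_iff\<close>)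
      also have "(1 - x k / real (Suc k)) - (1 - c / real (Suc k)) = (c - x k) / real (Suc k)"
        by (simp add: diff_divide_distrib)
      also have "real (Suc k) * norm \<dots> = \<bar>x k - c\<bar>"
        by (simp add: abs_minus_commute del: of_nat_Suc)
      finally show "norm ((1 - x k / real (Suc k)) ^ Suc k - (1 - c / real (Suc k)) ^ Suc k) \<le> \<bar>x k - c\<bar>" .
    qed
    show "(\<lambda>k. \<bar>x k - c\<bar>) \<longlonglongrightarrow> 0"
      using lim by (simp add: LIM_zero_iff tendsto_rabs_zero_iff)
  qed
  from tendsto_add[OF this base] show ?thesis by simp
qed

context transform_setting
begin

text \<open>
  The Levy measure behind \<open>\<sigma>\<close> may be infinite near \<open>0\<close>, so the law is obtained as the limit
  of the \<open>n\<close>-fold convolution powers of the thinned laws, whose transforms \<open>(1 - \<sigma>\<^sub>n / n) ^ n\<close> tend to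
  \<open>exp (- \<sigma>)\<close>. Their means are all \<open>\<mu>\<close> and their second moments are bounded.
\<close>
lemma exp_sigma_is_laplace:
  assumes iT: "integrable FT (\<lambda>t. t)"
  obtains G where "second_order_law G \<mu>"
    "\<And>s. 0 \<le> s \<Longrightarrow> laplace_stieltjes G s = exp (- sigma_transform FT F s)"
proof -
  let ?n = "\<lambda>k. real (Suc k)"
  let ?H = "\<lambda>k. thinned_law (?n k)"
  have "\<exists>G. second_order_law G \<mu> \<and> (LINT x|G. x\<^sup>2) \<le> X.m2 * (T.expectation (\<lambda>t. t) + 1) + \<mu>\<^sup>2
      \<and> (\<forall>s\<ge>0. laplace_stieltjes G s = laplace_stieltjes (?H k) s ^ Suc k)" for k
  proof -
    have pos: "0 < ?n k" by simp
    note H = thinned_law_moments[OF pos iT]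
    obtain G where G: "second_order_law G (?n k * (\<mu> / ?n k))"
      "(LINT x|G. x\<^sup>2) = ?n k * (LINT x|?H k. x\<^sup>2) + ?n k * (?n k - 1) * (\<mu> / ?n k)\<^sup>2"
      "\<forall>s\<ge>0. laplace_stieltjes G s = laplace_stieltjes (?H k) s ^ Suc k"
      using convolution_power_law[OF H(1), of "Suc k"] by blast
    have "T.expectation (\<lambda>t. max t (1 / ?n k)) \<le> T.expectation (\<lambda>t. t + 1)"
    proof (rule integral_mono_AE)
      show "AE t in FT. max t (1 / ?n k) \<le> t + 1"
      proof (rule eventually_mono[OF T.nonneg])
        fix t :: real assume "0 \<le> t"
        moreover have "1 / ?n k \<le> 1" by simp
        ultimately show "max t (1 / ?n k) \<le> t + 1" by linarith
      qed
    qed (use iT in auto)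
    then have U: "T.expectation (\<lambda>t. max t (1 / ?n k)) \<le> T.expectation (\<lambda>t. t) + 1"
      using iT T.prob_space by simp
    have "?n k * (?n k - 1) * (\<mu> / ?n k)\<^sup>2 \<le> \<mu>\<^sup>2"
    proof -
      have "?n k * (?n k - 1) * (\<mu> / ?n k)\<^sup>2 = (1 - 1 / ?n k) * \<mu>\<^sup>2"
        using pos by (simp add: power2_eq_square field_simps del: of_nat_Suc)
      also have "\<dots> \<le> 1 * \<mu>\<^sup>2" by (intro mult_right_mono) auto
      finally show ?thesis by simp
    qed
    moreover have "?n k * (LINT x|?H k. x\<^sup>2) \<le> X.m2 * (T.expectation (\<lambda>t. t) + 1)"
    proof -
      have "?n k * (LINT x|?H k. x\<^sup>2) = X.m2 * T.expectation (\<lambda>t. max t (1 / ?n k))"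
        unfolding H(2) using pos by (simp del: of_nat_Suc)
      also have "\<dots> \<le> X.m2 * (T.expectation (\<lambda>t. t) + 1)"
        by (intro mult_left_mono U) simp
      finally show ?thesis .
    qed
    ultimately show ?thesis using G pos by (intro exI[of _ G]) (auto simp del: of_nat_Suc)
  qed
  then obtain G where G: "\<And>k. second_order_law (G k) \<mu>"
    "\<And>k. (LINT x|G k. x\<^sup>2) \<le> X.m2 * (T.expectation (\<lambda>t. t) + 1) + \<mu>\<^sup>2"
    "\<And>k s. 0 \<le> s \<Longrightarrow> laplace_stieltjes (G k) s = laplace_stieltjes (?H k) s ^ Suc k"
    by metis
  have "(\<lambda>k. laplace_stieltjes (G k) s) \<longlonglongrightarrow> exp (- sigma_transform FT F s)" if s: "0 \<le> s" for s
  proof -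
    have H: "laplace_stieltjes (?H k) s
        = 1 - T.expectation (\<lambda>t. sigma_kernel F \<mu> s (max t (1 / ?n k))) / ?n k" for k
      by (rule thinned_law_moments(3)[OF _ iT s]) simp
    show ?thesis
      unfolding G(3)[OF s] H
    proof (rule one_minus_div_power_tendsto_exp[OF truncated_sigma_tendsto[OF s]])
      fix k
      interpret H: second_order_law "?H k" "\<mu> / ?n k"
        by (rule thinned_law_moments(1)[OF _ iT]) simp
      show "0 \<le> 1 - T.expectation (\<lambda>t. sigma_kernel F \<mu> s (max t (1 / ?n k))) / ?n k"
        using H.laplace_nonneg[of s] unfolding H .
      show "0 \<le> T.expectation (\<lambda>t. sigma_kernel F \<mu> s (max t (1 / ?n k)))"
        using sigma_kernel_bounds(1)[OF s] by (intro integral_nonneg_AE AE_I2) (simp add: le_max_iff_disj)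
    qed
  qed
  from laplace_limit_is_law[OF G(1,2) this] that show thesis by blast
qed

lemma sigma_transform_antimono:
  assumes Y: "second_order_law G \<mu>" and s: "0 \<le> s"
    and le: "\<And>u. 0 \<le> u \<Longrightarrow> laplace_stieltjes F u \<le> laplace_stieltjes G u"
  shows "sigma_transform FT G s \<le> sigma_transform FT F s"
proof -
  interpret Y: transform_setting FT G \<mu>
    using Y by (simp add: transform_setting_def T.nonneg_law_axioms)
  show ?thesis
    unfolding sigma_transform_eq Y.sigma_transform_eq
  proof (rule integral_mono_AE[OF Y.integrable_sigma_kernel[OF s] integrable_sigma_kernel[OF s]])
    show "AE t in FT. sigma_kernel G \<mu> s t \<le> sigma_kernel F \<mu> s t"
      by (rule eventually_mono[OF T.nonneg])
         (use le s in \<open>auto simp: sigma_kernel_def intro!: divide_right_mono\<close>)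
  qed
qed

end

section \<open>Existence of a solution\<close>

lemma sigma_transform_tendsto:
  assumes FT: "nonneg_law FT" and f: "\<And>n. second_order_law (f n) \<mu>" and F: "second_order_law F \<mu>"
    and lim: "\<And>u. 0 \<le> u \<Longrightarrow> (\<lambda>n. laplace_stieltjes (f n) u) \<longlonglongrightarrow> laplace_stieltjes F u"
    and s: "0 \<le> s"
  shows "(\<lambda>n. sigma_transform FT (f n) s) \<longlonglongrightarrow> sigma_transform FT F s"
proof -
  interpret transform_setting FT F \<mu> using FT F by (simp add: transform_setting_def)
  interpret f: transform_setting FT "f n" \<mu> for n using FT f by (simp add: transform_setting_def)
  show ?thesis
    unfolding sigma_transform_eq f.sigma_transform_eq
  proof (rule integral_dominated_convergence[where w = "\<lambda>_. \<mu> * s"])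
    show "AE t in FT. (\<lambda>n. sigma_kernel (f n) \<mu> s t) \<longlonglongrightarrow> sigma_kernel F \<mu> s t"
    proof (rule eventually_mono[OF T.nonneg])
      fix t :: real assume "0 \<le> t"
      then show "(\<lambda>n. sigma_kernel (f n) \<mu> s t) \<longlonglongrightarrow> sigma_kernel F \<mu> s t"
        using lim[of "t * s"] s by (auto simp: sigma_kernel_def intro!: tendsto_intros)
    qed
    show "AE t in FT. norm (sigma_kernel (f n) \<mu> s t) \<le> \<mu> * s" for n
      by (rule eventually_mono[OF T.nonneg]) (use f.sigma_kernel_bounds[OF s] in auto)
  qed auto
qed

text \<open>
  Iteration of \<open>F \<mapsto>\<close> the law with transform \<open>exp (- \<sigma>)\<close>, started at the point mass at \<open>\<mu>\<close>, increases
  the transforms: the first step is \<open>\<sigma> s \<le> \<mu> * s\<close>, and the map is monotone in the transform. The second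
  moments obey \<open>m' = q * m + \<mu>\<^sup>2\<close> with \<open>q = E T\<close>, so for \<open>q < 1\<close> they stay below the fixed point
  \<open>\<mu>\<^sup>2 / (1 - q)\<close>, and the continuity theorem applies to the limit.
\<close>
lemma compound_poisson_solution_exists:
  assumes FT: "nonneg_law FT" and iT: "integrable FT (\<lambda>t. t)" and lt: "(LINT t|FT. t) < 1"
    and "0 < \<mu>"
  obtains F where "second_order_law F \<mu>"
    "\<And>s. 0 \<le> s \<Longrightarrow> laplace_stieltjes F s = exp (- sigma_transform FT F s)"
proof -
  interpret T: nonneg_law FT by fact
  define q where "q = T.expectation (\<lambda>t. t)"
  define C where "C = \<mu>\<^sup>2 / (1 - q)"
  have q: "0 \<le> q" "q < 1"
    using integral_nonneg_AE[OF T.nonneg] lt by (auto simp: q_def)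
  have C: "C * q + \<mu>\<^sup>2 = C"
    using q by (simp add: C_def field_simps)
  \<comment> \<open>The last conjunct of \<open>?P\<close> pins down the start of the sequence, where the monotonicity begins.\<close>
  let ?P = "\<lambda>k F. second_order_law F \<mu> \<and> (LINT x|F. x\<^sup>2) \<le> C
      \<and> (k = 0 \<longrightarrow> F = return borel \<mu>)"
  let ?Q = "\<lambda>F G. \<forall>s\<ge>0. laplace_stieltjes G s = exp (- sigma_transform FT F s)"
  have "\<exists>f. \<forall>k::nat. ?P k (f k) \<and> ?Q (f k) (f (Suc k))"
  proof (rule dependent_nat_choice)
    have "\<mu>\<^sup>2 \<le> C" using q by (simp add: C_def pos_le_divide_eq mult_left_le)
    then show "\<exists>F. ?P 0 F"
      using point_mass_law[of \<mu>] \<open>0 < \<mu>\<close> by (intro exI[of _ "return borel \<mu>"]) simp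
  next
    fix F and k :: nat assume "?P k F"
    then have F: "second_order_law F \<mu>" and m2: "(LINT x|F. x\<^sup>2) \<le> C" by auto
    interpret transform_setting FT F \<mu> using FT F by (simp add: transform_setting_def)
    obtain G where G: "second_order_law G \<mu>"
      "\<And>s. 0 \<le> s \<Longrightarrow> laplace_stieltjes G s = exp (- sigma_transform FT F s)"
      using exp_sigma_is_laplace[OF iT] by blast
    have "(LINT x|G. x\<^sup>2) = X.m2 * q + \<mu>\<^sup>2"
      using second_moment_relation(2)[OF G(1) \<open>0 < \<mu>\<close> G(2)] by (simp add: q_def)
    also have "\<dots> \<le> C * q + \<mu>\<^sup>2"
      using m2 q by (simp add: mult_right_mono)
    finally show "\<exists>G. ?P (Suc k) G \<and> ?Q F G"
      using G C by (intro exI[of _ G]) simp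
  qed
  then obtain f where P: "\<And>k. ?P k (f k)" and Q: "\<And>k. ?Q (f k) (f (Suc k))" by blast
  have law: "second_order_law (f k) \<mu>" for k using P by blast
  interpret f: transform_setting FT "f k" \<mu> for k
    using FT law by (simp add: transform_setting_def)
  have mono: "laplace_stieltjes (f k) s \<le> laplace_stieltjes (f (Suc k)) s" if "0 \<le> s" for k s
    using that
  proof (induction k arbitrary: s)
    case 0
    have "laplace_stieltjes (f 0) s = exp (- (s * \<mu>))"
      using P[of 0] point_mass_law(3)[of \<mu> s] \<open>0 < \<mu>\<close> by simp
    also have "\<dots> \<le> exp (- sigma_transform FT (f 0) s)"
      using f.sigma_transform_le[OF 0, of 0] by (simp add: mult.commute)
    finally show ?case using Q[of 0] 0 by simp
  next
    case (Suc k)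
    have "sigma_transform FT (f (Suc k)) s \<le> sigma_transform FT (f k) s"
      by (rule f.sigma_transform_antimono[OF law Suc.prems Suc.IH])
    then show ?case using Q[of k] Q[of "Suc k"] Suc.prems by simp
  qed
  define \<phi> where "\<phi> s = lim (\<lambda>k. laplace_stieltjes (f k) s)" for s
  have lim: "(\<lambda>k. laplace_stieltjes (f k) s) \<longlonglongrightarrow> \<phi> s" if s: "0 \<le> s" for s
  proof -
    have "convergent (\<lambda>k. laplace_stieltjes (f k) s)"
    proof (rule Bseq_monoseq_convergent)
      show "Bseq (\<lambda>k. laplace_stieltjes (f k) s)"
        by (rule BseqI'[where K = 1]) (simp add: f.X.laplace_nonneg f.X.laplace_le_1[OF s])
      show "monoseq (\<lambda>k. laplace_stieltjes (f k) s)"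
        by (rule mono_SucI1) (use mono[OF s] in blast)
    qed
    then show ?thesis by (simp add: convergent_LIMSEQ_iff \<phi>_def)
  qed
  have bound: "(LINT x|f k. x\<^sup>2) \<le> C" for k using P by blast
  obtain F where F: "second_order_law F \<mu>"
    and lap: "\<And>s. 0 \<le> s \<Longrightarrow> laplace_stieltjes F s = \<phi> s"
    using laplace_limit_is_law[OF law bound lim] by blast
  have "laplace_stieltjes F s = exp (- sigma_transform FT F s)" if s: "0 \<le> s" for s
  proof (rule LIMSEQ_unique)
    show "(\<lambda>k. laplace_stieltjes (f (Suc k)) s) \<longlonglongrightarrow> laplace_stieltjes F s"
      using LIMSEQ_Suc[OF lim[OF s]] lap[OF s] by simp
    have "(\<lambda>k. exp (- sigma_transform FT (f k) s)) \<longlonglongrightarrow> exp (- sigma_transform FT F s)"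
      by (intro tendsto_intros sigma_transform_tendsto[OF FT law F _ s]) (use lim lap in simp)
    then show "(\<lambda>k. laplace_stieltjes (f (Suc k)) s) \<longlonglongrightarrow> exp (- sigma_transform FT F s)"
      using Q s by simp
  qed
  with F show thesis by (rule that)
qed

section \<open>Necessity and the variance\<close>

text \<open>
  With \<open>G = F\<close> the second-moment relation reads \<open>m2 * (1 - E T) = \<mu>\<^sup>2\<close>; as \<open>\<mu>\<^sup>2\<close> is positive, so is
  \<open>1 - E T\<close>, and solving for \<open>m2\<close> gives the variance.
\<close>
lemma solution_moments:
  assumes FT: "nonneg_law FT" and F: "second_order_law F \<mu>" and "0 < \<mu>"
    and sol: "\<And>s. 0 \<le> s \<Longrightarrow> laplace_stieltjes F s = exp (- sigma_transform FT F s)"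
  shows "integrable FT (\<lambda>t. t)" and "(LINT t|FT. t) < 1"
    and "prob_space.variance F (\<lambda>x. x) = (LINT t|FT. t) / (1 - (LINT t|FT. t)) * \<mu>\<^sup>2"
proof -
  interpret transform_setting FT F \<mu> using FT F by (simp add: transform_setting_def)
  note rel = second_moment_relation[OF F \<open>0 < \<mu>\<close> sol]
  show "integrable FT (\<lambda>t. t)" by (rule rel(1))
  let ?q = "T.expectation (\<lambda>t. t)"
  have key: "X.m2 * (1 - ?q) = \<mu>\<^sup>2" using rel(2) by (simp add: algebra_simps)
  have "0 < \<mu>\<^sup>2" using \<open>0 < \<mu>\<close> by simp
  then have "0 < X.m2 * (1 - ?q)" "0 < X.m2" using key X.mean_square_le_m2 by linarith+
  then have "0 < 1 - ?q" by (simp add: zero_less_mult_iff)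
  then show "?q < 1" by simp
  have "X.variance (\<lambda>x. x) = X.m2 * ?q"
    using X.variance_eq_m2 rel(2) by simp
  also have "X.m2 = \<mu>\<^sup>2 / (1 - ?q)"
    using key \<open>0 < 1 - ?q\<close> by (simp add: field_simps)
  finally show "X.variance (\<lambda>x. x) = ?q / (1 - ?q) * \<mu>\<^sup>2" by (simp add: mult_ac)
qed

theorem corollary2:
  fixes M :: "'a measure" and T :: "'a \<Rightarrow> real" and \<mu> :: real
  assumes "prob_space M"
    and "T \<in> borel_measurable M"
    and "AE \<omega> in M. 0 \<le> T \<omega>"
    and "0 < \<mu>"
  shows "((integrable M T \<and> 0 \<le> prob_space.expectation M T \<and> prob_space.expectation M T < 1)
          \<longleftrightarrow> (\<exists>!F. nonneg_distribution F \<and> has_mean_finite_variance F \<mu> \<and>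
                   solves_compound_poisson_eq (distr M borel T) F))
       \<and> ((integrable M T \<and> 0 \<le> prob_space.expectation M T \<and> prob_space.expectation M T < 1)
          \<longrightarrow> (\<forall>F. nonneg_distribution F \<and> has_mean_finite_variance F \<mu> \<and>
                   solves_compound_poisson_eq (distr M borel T) F
                \<longrightarrow> prob_space.variance F (\<lambda>x. x)
                    = prob_space.expectation M T / (1 - prob_space.expectation M T) * \<mu>\<^sup>2))"
proof -
  interpret prob_space M by fact
  let ?FT = "distr M borel T"
  note [measurable] = assms(2)
  have FT: "nonneg_law ?FT"
  proof (rule nonneg_law.intro)
    show "real_distribution ?FT" by simp
    show "nonneg_law_axioms ?FT"
      using assms(3) by unfold_locales (simp add: AE_distr_iff)
  qed
  have int: "integrable ?FT (\<lambda>t. t) \<longleftrightarrow> integrable M T"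
    by (simp add: integrable_distr_eq)
  have E: "(LINT t|?FT. t) = expectation T"
    by (simp add: integral_distr)
  have E_nonneg: "0 \<le> expectation T"
    by (rule integral_nonneg_AE[OF assms(3)])
  have sol_iff: "nonneg_distribution F \<and> has_mean_finite_variance F \<mu> \<and> solves_compound_poisson_eq ?FT F
      \<longleftrightarrow> second_order_law F \<mu> \<and> (\<forall>s\<ge>0. laplace_stieltjes F s = exp (- sigma_transform ?FT F s))" for F
    using second_order_law_iff[of F \<mu>] by (auto simp: solves_compound_poisson_eq_def)
  have necessary: "integrable M T \<and> expectation T < 1
      \<and> prob_space.variance F (\<lambda>x. x) = expectation T / (1 - expectation T) * \<mu>\<^sup>2"
    if "second_order_law F \<mu>" "\<forall>s\<ge>0. laplace_stieltjes F s = exp (- sigma_transform ?FT F s)" for F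
    using solution_moments[OF FT that(1) \<open>0 < \<mu>\<close>] that(2) int E by simp
  have sufficient: "\<exists>!F. second_order_law F \<mu> \<and> (\<forall>s\<ge>0. laplace_stieltjes F s = exp (- sigma_transform ?FT F s))"
    if "integrable M T" "expectation T < 1"
  proof -
    have T: "integrable ?FT (\<lambda>t. t)" "(LINT t|?FT. t) < 1" using that int E by auto
    show ?thesis
      using compound_poisson_solution_exists[OF FT T \<open>0 < \<mu>\<close>]
        solution_unique[OF _ _ FT _ _ T] by metis
  qed
  show ?thesis
    unfolding sol_iff using necessary sufficient E_nonneg by blast
qed

end
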